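(* Let $f:(0,\infty)\to(0,\infty)$ be operator monotone, extended by $f(0)=0$. Let $\phi:\mathbb{M}_n\to\mathbb{M}_m$ be a linear map satisfying the Schwarz inequality $\phi(K^*K)\geq\phi(K)^*\phi(K)$ for all $K\in\mathbb{M}_n$ (no unitality assumed), with Hilbert–Schmidt adjoint $\phi^*$. Then for all positive definite $X,Y\in\mathbb{M}_m$: (a) $\phi\,\mathbb{J}_f(\phi^*(X),\phi^*(Y))^{+}\,\phi^*\leq\mathbb{J}_f(X,Y)^{-1}$ as operators on $\mathcal{H}_m$; (b) $\phi^*\,\mathbb{J}_f(X,Y)\,\phi\leq\mathbb{J}_f(\phi^*(X),\phi^*(Y))$ as operators on $\mathcal{H}_n$.
   Context: $\mathcal{H}_k$ denotes $\mathbb{M}_k$ (complex $k\times k$ matrices) with the Hilbert–Schmidt inner product $\langle A,B\rangle=\mathrm{Tr}[A^*B]$; $\phi:\mathcal{H}_n\to\mathcal{H}_m$ and $\phi^*:\mathcal{H}_m\to\mathcal{H}_n$ is its adjoint. For $X\in\mathbb{M}_k$, $L_X(A)=XA$ and $R_X(A)=AX$ are operators on $\mathcal{H}_k$; for positive semidefinite $X,Y$ they are commuting positive semidefinite operators. For positive semidefinite $X,Y\in\mathbb{M}_k$ define the positive semidefinite operator $\mathbb{J}_f(X,Y):=f(R_XL_Y^{+})L_Y$ on $\mathcal{H}_k$, where $L_Y^+$ is the Moore–Penrose generalized inverse of $L_Y$ and $f$ is applied via functional calculus (with $f(0)=0$). $T^+$ denotes the Moore–Penrose inverse of an operator $T$,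 and $\leq$ is the Loewner order. *)

theory Defs
  imports "Jordan_Normal_Form.Schur_Decomposition"
begin

(* Matrices in M_k are complex mat of carrier_mat k k; operators on H_k are
   maps complex mat => complex mat, considered on carrier_mat k k only. *)

definition mtrace :: "complex mat \<Rightarrow> complex" where
  "mtrace A = (\<Sum>i<dim_row A. A $$ (i,i))"

definition hs_inner :: "complex mat \<Rightarrow> complex mat \<Rightarrow> complex" where
  "hs_inner A B = mtrace (mat_adjoint A * B)"

definition psd_mat :: "nat \<Rightarrow> complex mat \<Rightarrow> bool" where
  "psd_mat k X \<longleftrightarrow> X \<in> carrier_mat k k \<and> (\<forall>v\<in>carrier_vec k. (X *\<^sub>v v) \<bullet>c v \<ge> 0)"

definition pd_mat :: "nat \<Rightarrow> complex mat \<Rightarrow> bool" where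
  "pd_mat k X \<longleftrightarrow> X \<in> carrier_mat k k \<and>
     (\<forall>v\<in>carrier_vec k. v \<noteq> 0\<^sub>v k \<longrightarrow> (X *\<^sub>v v) \<bullet>c v > 0)"

definition mat_le :: "nat \<Rightarrow> complex mat \<Rightarrow> complex mat \<Rightarrow> bool" where
  "mat_le k A B \<longleftrightarrow> A \<in> carrier_mat k k \<and> B \<in> carrier_mat k k \<and> psd_mat k (B - A)"

(* functional calculus of a (Hermitian, hence diagonalizable) matrix:
   f(X) acts as f(lambda) on each eigenvector with eigenvalue lambda *)
definition mat_fun :: "nat \<Rightarrow> (real \<Rightarrow> real) \<Rightarrow> complex mat \<Rightarrow> complex mat" where
  "mat_fun k f X = (SOME B. B \<in> carrier_mat k k \<and>
     (\<forall>c v. eigenvector X v c \<longrightarrow> B *\<^sub>v v = complex_of_real (f (Re c)) \<cdot>\<^sub>v v))"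

definition op_monotone :: "(real \<Rightarrow> real) \<Rightarrow> bool" where
  "op_monotone f \<longleftrightarrow> (\<forall>k A B. pd_mat k A \<and> pd_mat k B \<and> mat_le k A B \<longrightarrow>
       mat_le k (mat_fun k f A) (mat_fun k f B))"

definition lin_map :: "nat \<Rightarrow> nat \<Rightarrow> (complex mat \<Rightarrow> complex mat) \<Rightarrow> bool" where
  "lin_map n m \<phi> \<longleftrightarrow> (\<forall>A\<in>carrier_mat n n. \<phi> A \<in> carrier_mat m m) \<and>
     (\<forall>A\<in>carrier_mat n n. \<forall>B\<in>carrier_mat n n. \<phi> (A + B) = \<phi> A + \<phi> B) \<and>
     (\<forall>c. \<forall>A\<in>carrier_mat n n. \<phi> (c \<cdot>\<^sub>m A) = c \<cdot>\<^sub>m \<phi> A)"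

definition hs_adjoint :: "nat \<Rightarrow> nat \<Rightarrow> (complex mat \<Rightarrow> complex mat) \<Rightarrow> (complex mat \<Rightarrow> complex mat) \<Rightarrow> bool" where
  "hs_adjoint n m \<phi> \<psi> \<longleftrightarrow> (\<forall>B\<in>carrier_mat m m. \<psi> B \<in> carrier_mat n n) \<and>
     (\<forall>A\<in>carrier_mat n n. \<forall>B\<in>carrier_mat m m. hs_inner (\<phi> A) B = hs_inner A (\<psi> B))"

definition op_sa :: "nat \<Rightarrow> (complex mat \<Rightarrow> complex mat) \<Rightarrow> bool" where
  "op_sa k T \<longleftrightarrow> (\<forall>A\<in>carrier_mat k k. \<forall>B\<in>carrier_mat k k. hs_inner (T A) B = hs_inner A (T B))"

definition op_psd :: "nat \<Rightarrow> (complex mat \<Rightarrow> complex mat) \<Rightarrow> bool" where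
  "op_psd k T \<longleftrightarrow> (\<forall>A\<in>carrier_mat k k. hs_inner A (T A) \<ge> 0)"

definition op_le :: "nat \<Rightarrow> (complex mat \<Rightarrow> complex mat) \<Rightarrow> (complex mat \<Rightarrow> complex mat) \<Rightarrow> bool" where
  "op_le k S T \<longleftrightarrow> op_psd k (\<lambda>A. T A - S A)"

definition op_mp :: "nat \<Rightarrow> (complex mat \<Rightarrow> complex mat) \<Rightarrow> (complex mat \<Rightarrow> complex mat)" where
  "op_mp k T = (SOME S. lin_map k k S \<and>
     (\<forall>A\<in>carrier_mat k k. T (S (T A)) = T A \<and> S (T (S A)) = S A) \<and>
     op_sa k (T \<circ> S) \<and> op_sa k (S \<circ> T))"

definition op_inv :: "nat \<Rightarrow> (complex mat \<Rightarrow> complex mat) \<Rightarrow> (complex mat \<Rightarrow> complex mat)" where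
  "op_inv k T = (SOME S. lin_map k k S \<and> (\<forall>A\<in>carrier_mat k k. S (T A) = A \<and> T (S A) = A))"

(* functional calculus of a diagonalizable (here: positive semidefinite) operator on H_k *)
definition op_fun :: "nat \<Rightarrow> (real \<Rightarrow> real) \<Rightarrow> (complex mat \<Rightarrow> complex mat) \<Rightarrow> (complex mat \<Rightarrow> complex mat)" where
  "op_fun k f T = (SOME S. lin_map k k S \<and>
     (\<forall>c A. A \<in> carrier_mat k k \<and> A \<noteq> 0\<^sub>m k k \<and> T A = c \<cdot>\<^sub>m A \<longrightarrow>
        S A = complex_of_real (f (Re c)) \<cdot>\<^sub>m A))"

definition lmul :: "complex mat \<Rightarrow> complex mat \<Rightarrow> complex mat" where
  "lmul X = (\<lambda>A. X * A)"

definition rmul :: "complex mat \<Rightarrow> complex mat \<Rightarrow> complex mat" where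
  "rmul X = (\<lambda>A. A * X)"

definition Jf :: "nat \<Rightarrow> (real \<Rightarrow> real) \<Rightarrow> complex mat \<Rightarrow> complex mat \<Rightarrow> (complex mat \<Rightarrow> complex mat)" where
  "Jf k f X Y = op_fun k f (rmul X \<circ> op_mp k (lmul Y)) \<circ> lmul Y"

end

theory Submission
  imports Defs "Jordan_Normal_Form.Spectral_Radius"
begin

text \<open>
  Diagonalise \<open>Y = U diag(\<mu>) U\<^sup>*\<close> and \<open>X = W diag(\<kappa>) W\<^sup>*\<close>. In the coordinates \<open>U\<^sup>* A W\<close> of \<open>A\<close>
  the operators \<open>L\<^sub>Y\<close> and \<open>R\<^sub>X\<close> are diagonal, and \<open>J\<^sub>f(X,Y)\<close> is the Schur multiplier with symbol
  \<open>f(\<kappa>\<^sub>j / \<mu>\<^sub>i) \<mu>\<^sub>i\<close>; similarly for \<open>\<phi>\<^sup>*(X)\<close> and \<open>\<phi>\<^sup>*(Y)\<close>. The Schwarz inequality, paired with \<open>X\<close> and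
  \<open>Y\<close> under the trace, says that \<open>\<phi>\<^sup>* R\<^sub>X \<phi>\<close> and \<open>\<phi>\<^sup>* L\<^sub>Y \<phi>\<close> are dominated by the right and left
  multiplications by \<open>\<phi>\<^sup>*(X)\<close> and \<open>\<phi>\<^sup>*(Y)\<close>. After rescaling by \<open>L\<^sub>Y\<close> this becomes: \<open>w\<close> is a contraction and
  \<open>w\<^sup>* T w \<le> S\<close> with \<open>T, S\<close> diagonal, and (b) becomes Hansen's inequality \<open>w\<^sup>* f(T) w \<le> f(S)\<close>. The
  latter follows from operator monotonicity by dilating \<open>w\<close> to an isometry \<open>Z\<close> and comparing \<open>T\<close>
  with an operator that is almost \<open>S\<close> on the range of \<open>Z\<close> and a large constant on its complement.
  Part (a) follows from (b) by completing the square.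
\<close>

section \<open>The spectral theorem for positive semidefinite matrices\<close>

text \<open>Three obstacles shape the details. \<open>op_monotone\<close> compares positive definite
  matrices only and includes no continuity, while the dilation pads with a block that would
  naturally be 0. Every comparison therefore carries a positive slack \<open>h\<close>; the version
  with slack already yields midpoint concavity up to slack, hence right continuity of
  \<open>f\<close> at positive points, and that removes the slack. Next, \<open>\<phi>adj X\<close>
  and \<open>\<phi>adj Y\<close> may be singular and \<open>f\<close> may jump at 0 (a positive
  constant is operator monotone), so approximation by definite matrices would lose the convention
  \<open>f 0 = 0\<close>; instead the Schwarz bounds force \<open>\<phi>\<close> to vanish on
  coordinates with a zero eigenvalue. Finally, the Schwarz inequality bounds
  \<open>K\<^sup>* K\<close>, which suits right multiplication; left multiplication needs
  \<open>K K\<^sup>*\<close>, hence that \<open>\<phi>\<close> preserves adjoints, which has to be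
  extracted from the inequality.\<close>

lemma mat_adjoint_carrier [simp, intro]:
  "A \<in> carrier_mat n m \<Longrightarrow> mat_adjoint A \<in> carrier_mat m n"
  unfolding mat_adjoint_def by (auto simp: mat_of_rows_def)

lemma mat_adjoint_dim [simp]:
  "dim_row (mat_adjoint A) = dim_col A" "dim_col (mat_adjoint A) = dim_row A"
  unfolding mat_adjoint_def by (auto simp: mat_of_rows_def)

lemma mat_adjoint_index [simp]:
  "i < dim_col A \<Longrightarrow> j < dim_row A \<Longrightarrow> mat_adjoint A $$ (i, j) = conjugate (A $$ (j, i))"
  unfolding mat_adjoint_def by (auto simp: mat_of_rows_def)

lemma mat_adjoint_adjoint [simp]:
  fixes A :: "complex mat"
  shows "mat_adjoint (mat_adjoint A) = A"
  by (rule eq_matI) auto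

lemma mat_adjoint_mult:
  fixes A B :: "complex mat"
  assumes "A \<in> carrier_mat n m" "B \<in> carrier_mat m k"
  shows "mat_adjoint (A * B) = mat_adjoint B * mat_adjoint A"
  by (rule eq_matI) (use assms in \<open>auto simp: scalar_prod_def mult.commute\<close>)

lemma mat_adjoint_add:
  fixes A B :: "complex mat"
  assumes "A \<in> carrier_mat n m" "B \<in> carrier_mat n m"
  shows "mat_adjoint (A + B) = mat_adjoint A + mat_adjoint B"
  by (rule eq_matI) (use assms in auto)

lemma mat_adjoint_smult:
  fixes A :: "complex mat"
  shows "mat_adjoint (c \<cdot>\<^sub>m A) = cnj c \<cdot>\<^sub>m mat_adjoint A"
  by (rule eq_matI) auto

lemma mat_adjoint_one [simp]: "mat_adjoint (1\<^sub>m n :: complex mat) = 1\<^sub>m n"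
  by (rule eq_matI) auto

lemma mult_mat_vec_unit:
  fixes A :: "complex mat"
  assumes "A \<in> carrier_mat n n" "j < n"
  shows "A *\<^sub>v unit_vec n j = col A j"
  using assms by (intro eq_vecI) auto

text \<open>Polarisation. In the order on complex numbers \<open>0 \<le> z\<close> includes that
  \<open>z\<close> is real, so the quadratic form is real; testing it on \<open>e_i + z e_j\<close>
  for \<open>z\<close> among 0, 1, -1, i, -i isolates the real and imaginary parts of the two
  off-diagonal entries.\<close>

lemma psd_mat_hermitian:
  assumes "psd_mat k A"
  shows "mat_adjoint A = A"
proof (rule eq_matI)
  have A: "A \<in> carrier_mat k k" using assms by (simp add: psd_mat_def)
  show "dim_row (mat_adjoint A) = dim_row A" "dim_col (mat_adjoint A) = dim_col A" using A by auto
  fix i j assume "i < dim_row A" "j < dim_col A"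
  then have ij: "i < k" "j < k" using A by auto
  have form: "(A *\<^sub>v (unit_vec k i + z \<cdot>\<^sub>v unit_vec k j)) \<bullet>c (unit_vec k i + z \<cdot>\<^sub>v unit_vec k j)
    = A $$ (i,i) + z * cnj z * A $$ (j,j) + z * A $$ (i,j) + cnj z * A $$ (j,i)" for z
  proof -
    let ?v = "unit_vec k i + z \<cdot>\<^sub>v unit_vec k j"
    have "A *\<^sub>v ?v = A *\<^sub>v unit_vec k i + z \<cdot>\<^sub>v (A *\<^sub>v unit_vec k j)"
      using A by (simp add: mult_add_distrib_mat_vec[of _ k k] mult_mat_vec[of _ k k])
    also have "\<dots> = col A i + z \<cdot>\<^sub>v col A j" using A ij by (simp add: mult_mat_vec_unit)
    finally have "(A *\<^sub>v ?v) \<bullet>c ?v = (\<Sum>l = 0..<k. (col A i + z \<cdot>\<^sub>v col A j) $ l * cnj (?v $ l))"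
      using A by (simp add: scalar_prod_def)
    also have "\<dots> = (\<Sum>l = 0..<k. (A $$ (l,i) + z * A $$ (l,j)) *
       ((if l = i then 1 else 0) + cnj z * (if l = j then 1 else 0)))"
      by (rule sum.cong) (use A ij in auto)
    also have "\<dots> = (\<Sum>l = 0..<k. (if l = i then A $$ (l,i) + z * A $$ (l,j) else 0)) +
      (\<Sum>l = 0..<k. (if l = j then cnj z * (A $$ (l,i) + z * A $$ (l,j)) else 0))"
      unfolding sum.distrib[symmetric] by (rule sum.cong) (auto simp: algebra_simps)
    also have "\<dots> = A $$ (i,i) + z * cnj z * A $$ (j,j) + z * A $$ (i,j) + cnj z * A $$ (j,i)"
      using ij by (simp add: algebra_simps)
    finally show ?thesis .
  qed
  have real: "Im (A $$ (i,i) + z * cnj z * A $$ (j,j) + z * A $$ (i,j) + cnj z * A $$ (j,i)) = 0" for z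
  proof -
    have "unit_vec k i + z \<cdot>\<^sub>v unit_vec k j \<in> carrier_vec k" by simp
    then have "0 \<le> (A *\<^sub>v (unit_vec k i + z \<cdot>\<^sub>v unit_vec k j)) \<bullet>c (unit_vec k i + z \<cdot>\<^sub>v unit_vec k j)"
      using assms unfolding psd_mat_def by blast
    then show ?thesis unfolding form by (simp add: less_eq_complex_def)
  qed
  have "A $$ (i,j) = cnj (A $$ (j,i))"
    using real[of 0] real[of 1] real[of "-1"] real[of \<i>] real[of "-\<i>"]
    by (simp add: complex_eq_iff)
  then show "mat_adjoint A $$ (i,j) = A $$ (i,j)" using A ij by simp
qed

definition unitary_mat :: "nat \<Rightarrow> complex mat \<Rightarrow> bool" where
  "unitary_mat k U \<longleftrightarrow> U \<in> carrier_mat k k \<and> mat_adjoint U * U = 1\<^sub>m k \<and> U * mat_adjoint U = 1\<^sub>m k"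

lemma unitary_matI:
  assumes "U \<in> carrier_mat k k" "mat_adjoint U * U = 1\<^sub>m k"
  shows "unitary_mat k U"
  unfolding unitary_mat_def using assms
    mat_mult_left_right_inverse[of "mat_adjoint U" k U] by auto

definition rdiag :: "nat \<Rightarrow> (nat \<Rightarrow> real) \<Rightarrow> complex mat" where
  "rdiag k d = mat k k (\<lambda>(i,j). if i = j then complex_of_real (d i) else 0)"

lemma rdiag_carrier [simp, intro]: "rdiag k d \<in> carrier_mat k k"
  by (simp add: rdiag_def)

lemma cscalar_prod_adjoint:
  fixes A :: "complex mat"
  assumes "A \<in> carrier_mat n m" "v \<in> carrier_vec m" "w \<in> carrier_vec n"
  shows "(A *\<^sub>v v) \<bullet>c w = v \<bullet>c (mat_adjoint A *\<^sub>v w)"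
proof -
  have "(A *\<^sub>v v) \<bullet>c w = (\<Sum>i<n. \<Sum>j<m. A $$ (i,j) * v $ j * cnj (w $ i))"
    using assms by (simp add: scalar_prod_def sum_distrib_right lessThan_atLeast0)
  also have "\<dots> = (\<Sum>j<m. \<Sum>i<n. A $$ (i,j) * v $ j * cnj (w $ i))" by (rule sum.swap)
  also have "\<dots> = v \<bullet>c (mat_adjoint A *\<^sub>v w)"
    using assms by (auto simp: scalar_prod_def sum_distrib_left lessThan_atLeast0
        intro!: sum.cong)
  finally show ?thesis .
qed

lemma triple_mult_mat_vec:
  fixes A B C :: "complex mat"
  assumes "A \<in> carrier_mat n m" "B \<in> carrier_mat m k" "C \<in> carrier_mat k l" "v \<in> carrier_vec l"
  shows "(A * B * C) *\<^sub>v v = A *\<^sub>v (B *\<^sub>v (C *\<^sub>v v))"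
  using assms
  by (simp add: assoc_mult_mat[of A n m B k C l] assoc_mult_mat_vec[of A n m "B * C" l]
      assoc_mult_mat_vec[of B m k C l] mult_carrier_mat[of B m k C l])

lemma psd_mat_congruence:
  assumes "psd_mat n A" "U \<in> carrier_mat n m"
  shows "psd_mat m (mat_adjoint U * A * U)"
  unfolding psd_mat_def
proof (intro conjI ballI)
  have A: "A \<in> carrier_mat n n" using assms by (simp add: psd_mat_def)
  show "mat_adjoint U * A * U \<in> carrier_mat m m" using A assms by auto
  fix v :: "complex vec" assume v: "v \<in> carrier_vec m"
  have Uv: "U *\<^sub>v v \<in> carrier_vec n" using assms v by auto
  have "(mat_adjoint U * A * U) *\<^sub>v v = mat_adjoint U *\<^sub>v (A *\<^sub>v (U *\<^sub>v v))"
    using A assms(2) v by (intro triple_mult_mat_vec[of _ m n _ n _ m]) auto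
  then have "((mat_adjoint U * A * U) *\<^sub>v v) \<bullet>c v = (A *\<^sub>v (U *\<^sub>v v)) \<bullet>c (U *\<^sub>v v)"
    using cscalar_prod_adjoint[of "mat_adjoint U" m n "A *\<^sub>v (U *\<^sub>v v)" v] A assms(2) v Uv by simp
  then show "0 \<le> ((mat_adjoint U * A * U) *\<^sub>v v) \<bullet>c v"
    using assms(1) Uv unfolding psd_mat_def by simp
qed

section \<open>Diagonalisation by deflation\<close>

text \<open>Gram-Schmidt leaves the head of its list unchanged, so a completed basis with head
  \<open>v\<close> yields an orthogonal one with head \<open>v\<close>. It does not normalise; the
  factors \<open>r j\<close> do, and \<open>a\<close> is \<open>r 0\<close>.\<close>

lemma unitary_completion:
  fixes v :: "complex vec"
  assumes v: "v \<in> carrier_vec n" and v0: "v \<noteq> 0\<^sub>v n"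
  obtains U a where "unitary_mat n U" "col U 0 = a \<cdot>\<^sub>v v"
proof -
  define b where "b = basis_completion v"
  define ws where "ws = gram_schmidt n b"
  interpret cof_vec_space n "TYPE(complex)" .
  have n: "n \<noteq> 0" using v v0 by auto
  from basis_completion[OF v v0, folded b_def]
  have dist_b: "distinct b"
    and indep: "\<not> lin_dep (set b)" and b: "set b \<subseteq> carrier_vec n" and hdb: "hd b = v"
    and len_b: "length b = n" by auto
  from hdb len_b n obtain vs where bv: "b = v # vs" by (cases b, auto)
  from gram_schmidt_result[OF b dist_b indep refl, folded ws_def]
  have ws: "set ws \<subseteq> carrier_vec n" "corthogonal ws" "length ws = n"
    by (auto simp: len_b)
  from gram_schmidt_hd[OF v, of vs, folded bv] have hdws: "hd ws = v" unfolding ws_def .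
  have wsc: "ws ! i \<in> carrier_vec n" if "i < n" for i using ws that by auto
  define r where "r i = complex_of_real (1 / sqrt (Re (ws ! i \<bullet>c ws ! i)))" for i
  define U where "U = mat n n (\<lambda>(i,j). r j * (ws ! j) $ i)"
  have U: "U \<in> carrier_mat n n" by (simp add: U_def)
  have "mat_adjoint U * U = 1\<^sub>m n"
  proof (rule eq_matI)
    fix i j assume "i < dim_row (1\<^sub>m n :: complex mat)" "j < dim_col (1\<^sub>m n :: complex mat)"
    then have ij: "i < n" "j < n" by auto
    have "(mat_adjoint U * U) $$ (i,j) = (\<Sum>l = 0..<n. cnj (r i) * cnj (ws ! i $ l) * (r j * ws ! j $ l))"
      using ij by (auto simp: U_def scalar_prod_def)
    also have "\<dots> = r i * r j * (ws ! j \<bullet>c ws ! i)"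
      using ij wsc[of i] by (auto simp: scalar_prod_def r_def sum_distrib_left intro!: sum.cong)
    also have "\<dots> = (if i = j then 1 else 0)"
    proof (cases "i = j")
      case True
      have "ws ! i \<bullet>c ws ! i \<noteq> 0" using ws(2,3) ij by (auto simp: corthogonal_def)
      moreover have "ws ! i \<bullet>c ws ! i \<ge> 0" by auto
      ultimately have p: "Re (ws ! i \<bullet>c ws ! i) > 0"
        and e: "ws ! i \<bullet>c ws ! i = complex_of_real (Re (ws ! i \<bullet>c ws ! i))"
        by (auto simp: less_eq_complex_def complex_eq_iff)
      have "r i * r i * complex_of_real (Re (ws ! i \<bullet>c ws ! i)) = 1"
        using p unfolding r_def of_real_mult[symmetric] by (simp add: field_simps)
      then show ?thesis using e True by simp
    next
      case False
      then show ?thesis using ws(2,3) ij by (auto simp: corthogonal_def)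
    qed
    finally show "(mat_adjoint U * U) $$ (i,j) = 1\<^sub>m n $$ (i,j)" using ij by simp
  qed (use U in auto)
  then have "unitary_mat n U" using U by (rule unitary_matI[rotated])
  moreover have "col U 0 = r 0 \<cdot>\<^sub>v v"
  proof -
    have "ws ! 0 = v" using hdws ws(3) n by (metis hd_conv_nth list.size(3))
    then show ?thesis using n v by (auto simp: U_def)
  qed
  ultimately show thesis using that by blast
qed

text \<open>In an orthonormal basis that starts with an eigenvector, the first column is a multiple
  of the first unit vector; hermiticity then clears the first row as well, and the remaining block
  is handled by induction.\<close>

theorem psd_mat_spectral:
  assumes "psd_mat k A"
  obtains U d where "unitary_mat k U" "A = U * rdiag k d * mat_adjoint U" "\<And>i. i < k \<Longrightarrow> d i \<ge> 0"
proof -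
  have "\<exists>U d. unitary_mat k U \<and> mat_adjoint U * A * U = rdiag k d \<and> (\<forall>i<k. d i \<ge> 0)"
    using assms
  proof (induction k arbitrary: A)
    case 0
    then show ?case
      by (intro exI[of _ "1\<^sub>m 0"] exI[of _ "\<lambda>_. 0"])
        (auto simp: psd_mat_def unitary_mat_def rdiag_def)
  next
    case (Suc k)
    let ?n = "Suc k"
    have A: "A \<in> carrier_mat ?n ?n" using Suc.prems by (simp add: psd_mat_def)
    obtain e v where ev: "eigenvector A v e"
      using spectrum_non_empty[OF A] unfolding spectrum_def eigenvalue_def by auto
    then have v: "v \<in> carrier_vec ?n" "v \<noteq> 0\<^sub>v ?n" "A *\<^sub>v v = e \<cdot>\<^sub>v v"
      using A by (auto simp: eigenvector_def)
    obtain U a where U: "unitary_mat ?n U" "col U 0 = a \<cdot>\<^sub>v v"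
      using unitary_completion[OF v(1,2)] .
    have Uc: "U \<in> carrier_mat ?n ?n" and UU: "mat_adjoint U * U = 1\<^sub>m ?n"
      using U by (auto simp: unitary_mat_def)
    define B where "B = mat_adjoint U * A * U"
    have B: "psd_mat ?n B" unfolding B_def by (rule psd_mat_congruence[OF Suc.prems Uc])
    then have Bc: "B \<in> carrier_mat ?n ?n" by (simp add: psd_mat_def)
    have "col B 0 = e \<cdot>\<^sub>v unit_vec ?n 0"
    proof -
      have "col B 0 = B *\<^sub>v unit_vec ?n 0" using Bc by (simp add: mult_mat_vec_unit)
      also have "\<dots> = mat_adjoint U *\<^sub>v (A *\<^sub>v (U *\<^sub>v unit_vec ?n 0))"
        using A Uc unfolding B_def
        by (intro triple_mult_mat_vec[of _ ?n ?n _ ?n _ ?n]) auto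
      also have "U *\<^sub>v unit_vec ?n 0 = a \<cdot>\<^sub>v v" using Uc U(2) by (simp add: mult_mat_vec_unit)
      also have "A *\<^sub>v (a \<cdot>\<^sub>v v) = e \<cdot>\<^sub>v (a \<cdot>\<^sub>v v)" using A v
        by (simp add: mult_mat_vec[of _ ?n ?n] smult_smult_assoc mult.commute)
      also have "a \<cdot>\<^sub>v v = U *\<^sub>v unit_vec ?n 0" using Uc U(2) by (simp add: mult_mat_vec_unit)
      also have "mat_adjoint U *\<^sub>v (e \<cdot>\<^sub>v (U *\<^sub>v unit_vec ?n 0))
          = e \<cdot>\<^sub>v ((mat_adjoint U * U) *\<^sub>v unit_vec ?n 0)" using Uc
        by (simp add: mult_mat_vec[of _ ?n ?n] assoc_mult_mat_vec[of _ ?n ?n])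
      finally show ?thesis using UU by simp
    qed
    note colB = this
    have col0: "B $$ (i,0) = (if i = 0 then e else 0)" if "i < ?n" for i
    proof -
      have "B $$ (i,0) = col B 0 $ i" using that Bc by simp
      then show ?thesis using that unfolding colB by simp
    qed
    have row0: "B $$ (0,i) = (if i = 0 then e else 0)" if "i < ?n" for i
    proof -
      have "B $$ (0,i) = mat_adjoint B $$ (0,i)" using psd_mat_hermitian[OF B] by simp
      also have "\<dots> = cnj (B $$ (i,0))" using that Bc by simp
      finally show ?thesis using col0[OF that] psd_mat_hermitian[OF B] col0[of 0] Bc
        by (metis complex_cnj_zero zero_less_Suc)
    qed
    define C where "C = mat k k (\<lambda>(i,j). B $$ (Suc i, Suc j))"
    have Cc: "C \<in> carrier_mat k k" by (simp add: C_def)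
    \<comment> \<open>\<open>J\<close> is the inclusion of the last \<open>k\<close> coordinates.
      Writing \<open>C\<close> as a congruence of \<open>B\<close> by \<open>J\<close> transfers
      positivity to the block.\<close>
    define J :: "complex mat" where "J = mat ?n k (\<lambda>(i,j). if i = Suc j then 1 else 0)"
    have "C = mat_adjoint J * B * J"
    proof (rule eq_matI)
      fix i j assume "i < dim_row (mat_adjoint J * B * J)" "j < dim_col (mat_adjoint J * B * J)"
      then have ij: "i < k" "j < k" by (auto simp: J_def)
      have JB: "(mat_adjoint J * B) $$ (i, l) = B $$ (Suc i, l)" if "l < ?n" for l
      proof -
        have "(mat_adjoint J * B) $$ (i, l) = (\<Sum>q = 0..<?n. (if q = Suc i then B $$ (q,l) else 0))"
          using ij that Bc
          by (auto simp: J_def scalar_prod_def if_distrib[of cnj] if_distrib[of "\<lambda>x. x * _"] cong: if_cong)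
        then show ?thesis using ij by (simp add: sum.delta)
      qed
      have "(mat_adjoint J * B * J) $$ (i,j) = (\<Sum>q = 0..<?n. (mat_adjoint J * B) $$ (i, q) * J $$ (q, j))"
        using ij Bc by (auto simp: J_def scalar_prod_def)
      also have "\<dots> = (\<Sum>q = 0..<?n. (if q = Suc j then B $$ (Suc i, q) else 0))"
        using ij JB by (intro sum.cong) (auto simp: J_def)
      also have "\<dots> = B $$ (Suc i, Suc j)" using ij by (simp add: sum.delta)
      finally show "C $$ (i,j) = (mat_adjoint J * B * J) $$ (i,j)" using ij by (simp add: C_def)
    qed (auto simp: C_def J_def)
    then have "psd_mat k C" using psd_mat_congruence[OF B, of J k] by (simp add: J_def)
    from Suc.IH[OF this] obtain V d where V: "unitary_mat k V"
      and d: "mat_adjoint V * C * V = rdiag k d" "\<forall>i<k. d i \<ge> 0" by blast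
    have Vc: "V \<in> carrier_mat k k" and VV: "mat_adjoint V * V = 1\<^sub>m k"
      using V by (auto simp: unitary_mat_def)
    define E where "E = mat 1 1 (\<lambda>_. e)"
    have Ec: "E \<in> carrier_mat 1 1" by (simp add: E_def)
    have Bblock: "B = four_block_mat E (0\<^sub>m 1 k) (0\<^sub>m k 1) C"
      by (rule eq_matI) (use Bc col0 row0 in \<open>auto simp: E_def C_def\<close>)
    define W where "W = four_block_mat (1\<^sub>m 1) (0\<^sub>m 1 k) (0\<^sub>m k 1) V"
    have Wc: "W \<in> carrier_mat ?n ?n" using Vc unfolding W_def by auto
    have Wadj: "mat_adjoint W = four_block_mat (1\<^sub>m 1) (0\<^sub>m 1 k) (0\<^sub>m k 1) (mat_adjoint V)"
      by (rule eq_matI) (use Vc in \<open>auto simp: W_def\<close>)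
    have Vac: "mat_adjoint V \<in> carrier_mat k k" using Vc by auto
    have o1: "(1\<^sub>m 1 :: complex mat) \<in> carrier_mat 1 1" by simp
    have WW: "mat_adjoint W * W = 1\<^sub>m ?n"
      unfolding Wadj unfolding W_def
      by (subst mult_four_block_mat[OF o1 _ _ Vac o1 _ _ Vc])
        (use VV Vc Vac in \<open>auto simp: four_block_one_mat[of 1 k, simplified]\<close>)
    have d0: "mat_adjoint W * B * W = four_block_mat E (0\<^sub>m 1 k) (0\<^sub>m k 1) (rdiag k d)"
    proof -
      have WB: "mat_adjoint W * B = four_block_mat E (0\<^sub>m 1 k) (0\<^sub>m k 1) (mat_adjoint V * C)"
        unfolding Wadj Bblock
        by (subst mult_four_block_mat[OF o1 _ _ Vac Ec _ _ Cc]) (use Vc Vac Cc Ec in auto)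
      have VC: "mat_adjoint V * C \<in> carrier_mat k k" using Vc Cc by auto
      show ?thesis
        unfolding d(1)[symmetric] WB unfolding W_def
        by (subst mult_four_block_mat[OF Ec _ _ VC o1 _ _ Vc]) (use Vc Vac Cc Ec VC in auto)
    qed
    have ege: "e \<ge> 0"
    proof -
      have "(B *\<^sub>v unit_vec ?n 0) \<bullet>c unit_vec ?n 0 \<ge> 0"
        using B unfolding psd_mat_def by simp
      also have "(B *\<^sub>v unit_vec ?n 0) \<bullet>c unit_vec ?n 0 =
          (\<Sum>i = 0..<?n. if i = 0 then B $$ (i,0) else 0)"
        using Bc unfolding scalar_prod_def by (intro sum.cong) (auto simp: mult_mat_vec_unit)
      also have "\<dots> = e" using col0[of 0] by (subst sum.delta) auto
      finally show ?thesis .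
    qed
    define d' where "d' i = (case i of 0 \<Rightarrow> Re e | Suc j \<Rightarrow> d j)" for i
    have d': "\<forall>i<?n. d' i \<ge> 0" using ege d(2)
      by (auto simp: d'_def less_eq_complex_def split: nat.splits)
    have "four_block_mat E (0\<^sub>m 1 k) (0\<^sub>m k 1) (rdiag k d) = rdiag ?n d'"
      by (rule eq_matI) (use ege in \<open>auto simp: E_def rdiag_def d'_def less_eq_complex_def complex_eq_iff
         split: nat.splits\<close>)
    moreover have "unitary_mat ?n (U * W)"
    proof (rule unitary_matI)
      have "mat_adjoint (U * W) * (U * W) = mat_adjoint W * (mat_adjoint U * U) * W"
        using Uc Wc by (simp add: mat_adjoint_mult[of _ ?n ?n _ ?n] assoc_mult_mat[of _ ?n ?n _ ?n _ ?n]
           mult_carrier_mat[of _ ?n ?n])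
      then show "mat_adjoint (U * W) * (U * W) = 1\<^sub>m ?n" using UU WW Wc by simp
    qed (use Uc Wc in auto)
    moreover have "mat_adjoint (U * W) * A * (U * W) = mat_adjoint W * B * W"
      using Uc Wc A unfolding B_def
      by (simp add: mat_adjoint_mult[of _ ?n ?n _ ?n] assoc_mult_mat[of _ ?n ?n _ ?n _ ?n]
           mult_carrier_mat[of _ ?n ?n])
    ultimately show ?case using d0 d' by metis
  qed
  then obtain U d where U: "unitary_mat k U" "mat_adjoint U * A * U = rdiag k d" "\<forall>i<k. d i \<ge> 0" by blast
  have Uc: "U \<in> carrier_mat k k" "U * mat_adjoint U = 1\<^sub>m k" using U by (auto simp: unitary_mat_def)
  have A: "A \<in> carrier_mat k k" using assms by (simp add: psd_mat_def)
  have "U * rdiag k d * mat_adjoint U = (U * mat_adjoint U) * A * (U * mat_adjoint U)"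
    unfolding U(2)[symmetric] using Uc(1) A
    by (simp add: assoc_mult_mat[of _ k k _ k _ k] mult_carrier_mat[of _ k k])
  then have "A = U * rdiag k d * mat_adjoint U" using Uc A by simp
  then show thesis using that U by blast
qed

section \<open>Hansen's inequality\<close>

lemma unitary_matD:
  assumes "unitary_mat k U"
  shows "U \<in> carrier_mat k k" "mat_adjoint U * U = 1\<^sub>m k" "U * mat_adjoint U = 1\<^sub>m k"
  using assms by (auto simp: unitary_mat_def)

lemma pd_mat_imp_psd: "pd_mat k A \<Longrightarrow> psd_mat k A"
  unfolding pd_mat_def psd_mat_def
proof (intro conjI ballI, simp)
  fix v :: "complex vec" assume A: "A \<in> carrier_mat k k \<and> (\<forall>v\<in>carrier_vec k. v \<noteq> 0\<^sub>v k \<longrightarrow> 0 < (A *\<^sub>v v) \<bullet>c v)"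
    and v: "v \<in> carrier_vec k"
  show "0 \<le> (A *\<^sub>v v) \<bullet>c v"
  proof (cases "v = 0\<^sub>v k")
    case True
    then show ?thesis using A by (simp add: scalar_prod_def)
  next
    case False
    then show ?thesis using A v by (simp add: less_imp_le)
  qed
qed

lemma rdiag_mult_vec:
  assumes "v \<in> carrier_vec k"
  shows "rdiag k d *\<^sub>v v = vec k (\<lambda>i. complex_of_real (d i) * v $ i)"
proof (rule eq_vecI)
  fix i assume "i < dim_vec (vec k (\<lambda>i. complex_of_real (d i) * v $ i))"
  then have i: "i < k" by simp
  have "(rdiag k d *\<^sub>v v) $ i = (\<Sum>j = 0..<k. (if j = i then complex_of_real (d i) * v $ i else 0))"
    using i assms unfolding rdiag_def
    by (auto simp: scalar_prod_def if_distrib[of "\<lambda>x. x * _"] cong: if_cong)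
  then show "(rdiag k d *\<^sub>v v) $ i = vec k (\<lambda>i. complex_of_real (d i) * v $ i) $ i"
    using i by (simp add: sum.delta)
qed (simp add: rdiag_def)

lemma cscalar_prod_self:
  fixes v :: "complex vec"
  assumes "v \<in> carrier_vec n"
  shows "v \<bullet>c v = complex_of_real (\<Sum>i<n. (cmod (v $ i))\<^sup>2)"
  using assms unfolding scalar_prod_def
  by (auto simp: lessThan_atLeast0 complex_norm_square simp del: of_real_power intro!: sum.cong)

lemma rdiag_form:
  assumes "v \<in> carrier_vec k"
  shows "(rdiag k d *\<^sub>v v) \<bullet>c v = complex_of_real (\<Sum>i<k. d i * (cmod (v $ i))\<^sup>2)"
  using assms unfolding rdiag_mult_vec[OF assms] scalar_prod_def
  by (auto simp: lessThan_atLeast0 complex_norm_square mult.assoc simp del: of_real_power intro!: sum.cong)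

text \<open>\<open>mat_fun\<close> is a choice, so a witness is due: \<open>f\<close> applied to the
  diagonal factor. It treats every eigenvector correctly, not only the columns of \<open>U\<close>,
  because a nonzero coordinate \<open>w $ i\<close> of an eigenvector forces
  \<open>d i = Re c\<close>.\<close>

lemma mat_fun_eigenvector:
  assumes A: "psd_mat k A"
  shows "mat_fun k f A \<in> carrier_mat k k"
    and "eigenvector A v c \<Longrightarrow> mat_fun k f A *\<^sub>v v = complex_of_real (f (Re c)) \<cdot>\<^sub>v v"
proof -
  obtain U d where U: "unitary_mat k U" and AU: "A = U * rdiag k d * mat_adjoint U"
    using psd_mat_spectral[OF A] by metis
  have Ac: "A \<in> carrier_mat k k" using A by (simp add: psd_mat_def)
  note Uc = unitary_matD[OF U]
  let ?B = "U * rdiag k (f \<circ> d) * mat_adjoint U"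
  have "?B *\<^sub>v v = complex_of_real (f (Re c)) \<cdot>\<^sub>v v" if ev: "eigenvector A v c" for v c
  proof -
    have v: "v \<in> carrier_vec k" and Av: "A *\<^sub>v v = c \<cdot>\<^sub>v v" using ev Ac by (auto simp: eigenvector_def)
    define w where "w = mat_adjoint U *\<^sub>v v"
    have w: "w \<in> carrier_vec k" using v Uc by (simp add: w_def mult_mat_vec_carrier[of _ k k])
    have Uw: "U *\<^sub>v w = v" unfolding w_def using v Uc by (simp add: assoc_mult_mat_vec[of U k k _ k, symmetric])
    have "mat_adjoint U *\<^sub>v (A *\<^sub>v v) = mat_adjoint U *\<^sub>v (U *\<^sub>v (rdiag k d *\<^sub>v w))"
      unfolding AU w_def using v Uc by (simp add: triple_mult_mat_vec[of U k k _ k _ k])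
    also have "\<dots> = rdiag k d *\<^sub>v w"
      using w Uc assoc_mult_mat_vec[of "mat_adjoint U" k k U k "rdiag k d *\<^sub>v w"]
      by (simp add: mult_mat_vec_carrier[of _ k k])
    finally have "rdiag k d *\<^sub>v w = c \<cdot>\<^sub>v w"
      unfolding Av using v Uc by (simp add: w_def mult_mat_vec[of _ k k])
    then have e: "complex_of_real (d i) * w $ i = c * w $ i" if "i < k" for i
      unfolding rdiag_mult_vec[OF w] using that w by (metis carrier_vecD index_smult_vec(1) index_vec)
    have "rdiag k (f \<circ> d) *\<^sub>v w = complex_of_real (f (Re c)) \<cdot>\<^sub>v w"
      unfolding rdiag_mult_vec[OF w]
    proof (rule eq_vecI)
      fix i assume "i < dim_vec (complex_of_real (f (Re c)) \<cdot>\<^sub>v w)"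
      then have i: "i < k" using w by simp
      have "w $ i = 0 \<or> d i = Re c" using e[OF i] by (cases "w $ i = 0") auto
      then show "vec k (\<lambda>i. complex_of_real ((f \<circ> d) i) * w $ i) $ i = (complex_of_real (f (Re c)) \<cdot>\<^sub>v w) $ i"
        using i w by auto
    qed (use w in auto)
    moreover have "?B *\<^sub>v v = U *\<^sub>v (rdiag k (f \<circ> d) *\<^sub>v w)"
      unfolding w_def using v Uc by (intro triple_mult_mat_vec[of _ k k _ k _ k]) auto
    ultimately show ?thesis using Uw w Uc by (simp add: mult_mat_vec[of U k k])
  qed
  moreover have "?B \<in> carrier_mat k k" using Uc by auto
  ultimately have "\<exists>B. B \<in> carrier_mat k k \<and>
     (\<forall>c v. eigenvector A v c \<longrightarrow> B *\<^sub>v v = complex_of_real (f (Re c)) \<cdot>\<^sub>v v)" by blast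
  from someI_ex[OF this] have *: "mat_fun k f A \<in> carrier_mat k k \<and>
     (\<forall>c v. eigenvector A v c \<longrightarrow> mat_fun k f A *\<^sub>v v = complex_of_real (f (Re c)) \<cdot>\<^sub>v v)"
    unfolding mat_fun_def .
  show "mat_fun k f A \<in> carrier_mat k k" using * by simp
  show "eigenvector A v c \<Longrightarrow> mat_fun k f A *\<^sub>v v = complex_of_real (f (Re c)) \<cdot>\<^sub>v v" using * by blast
qed

lemma pd_rdiag:
  assumes "\<And>i. i < k \<Longrightarrow> t i > 0"
  shows "pd_mat k (rdiag k t)"
  unfolding pd_mat_def
proof (intro conjI ballI impI)
  fix v :: "complex vec" assume v: "v \<in> carrier_vec k" "v \<noteq> 0\<^sub>v k"
  then obtain i where i: "i < k" "v $ i \<noteq> 0" by (metis eq_vecI carrier_vecD index_zero_vec)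
  have "0 < t i * (cmod (v $ i))\<^sup>2" using i assms by simp
  also have "\<dots> \<le> (\<Sum>i<k. t i * (cmod (v $ i))\<^sup>2)"
    using i assms by (intro member_le_sum) (auto simp: less_imp_le)
  finally show "0 < (rdiag k t *\<^sub>v v) \<bullet>c v"
    unfolding rdiag_form[OF v(1)] by (simp add: less_complex_def)
qed simp

lemma eq_mat_colI:
  fixes A B :: "complex mat"
  assumes "A \<in> carrier_mat n m" "B \<in> carrier_mat n m" "\<And>j. j < m \<Longrightarrow> col A j = col B j"
  shows "A = B"
  by (rule mat_col_eqI) (use assms in auto)

lemma rdiag_col:
  assumes "j < k"
  shows "col (rdiag k d) j = complex_of_real (d j) \<cdot>\<^sub>v unit_vec k j"
  using assms by (intro eq_vecI) (auto simp: rdiag_def)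

lemma mat_fun_rdiag:
  assumes "\<And>i. i < k \<Longrightarrow> t i > 0"
  shows "mat_fun k f (rdiag k t) = rdiag k (f \<circ> t)"
proof (rule eq_mat_colI)
  note psd = pd_mat_imp_psd[OF pd_rdiag[OF assms]]
  show c: "mat_fun k f (rdiag k t) \<in> carrier_mat k k" by (rule mat_fun_eigenvector[OF psd])
  fix j assume j: "j < k"
  have "eigenvector (rdiag k t) (unit_vec k j) (complex_of_real (t j))"
    unfolding eigenvector_def using j by (simp add: mult_mat_vec_unit rdiag_col) (simp add: rdiag_def)
  from mat_fun_eigenvector(2)[OF psd this, of f]
  show "col (mat_fun k f (rdiag k t)) j = col (rdiag k (f \<circ> t)) j"
    using j c by (simp add: mult_mat_vec_unit rdiag_col)
qed simp

section \<open>Hansen's inequality with slack, for isometries and for contractions\<close>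

text \<open>The hypothesis bounds \<open>diag t\<close> only after compression by \<open>Z\<close>,
  whereas operator monotonicity needs an honest matrix inequality \<open>diag t \<le> M\<close>. The
  slack \<open>h\<close> pays for the cross terms. Since the range of \<open>Z\<close> is invariant
  under \<open>M\<close>, compressing \<open>f(M)\<close> back by \<open>Z\<close> gives exactly the
  values \<open>f (s a + h)\<close>.\<close>

lemma op_monotone_isometry:
  assumes f: "op_monotone f"
    and Z: "Z \<in> carrier_mat p q" "mat_adjoint Z * Z = 1\<^sub>m q"
    and t: "\<And>i. i < p \<Longrightarrow> t i > 0" and s: "\<And>a. a < q \<Longrightarrow> s a > 0" and h: "h > 0"
    and le: "\<And>u. u \<in> carrier_vec q \<Longrightarrow>
      (\<Sum>i<p. t i * (cmod ((Z *\<^sub>v u) $ i))\<^sup>2) \<le> (\<Sum>a<q. s a * (cmod (u $ a))\<^sup>2)"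
    and u: "u \<in> carrier_vec q"
  shows "(\<Sum>i<p. f (t i) * (cmod ((Z *\<^sub>v u) $ i))\<^sup>2) \<le> (\<Sum>a<q. f (s a + h) * (cmod (u $ a))\<^sup>2)"
proof -
  \<comment> \<open>\<open>e\<close> is small enough for \<open>(1 + e) * s a \<le> s a + h\<close>,
    and \<open>K\<close> large enough for \<open>(1 + 1/e) * t i \<le> K\<close>. The summand 1
    keeps \<open>sm\<close> positive when \<open>q = 0\<close>.\<close>
  define sm where "sm = 1 + (\<Sum>a<q. s a)"
  define e where "e = h / sm"
  define tm where "tm = (\<Sum>i<p. t i)"
  define K where "K = (1 + 1 / e) * tm"
  have sm: "sm > 0" unfolding sm_def by (intro add_pos_nonneg sum_nonneg) (auto simp: s less_imp_le)
  have e0: "e > 0" using sm h by (simp add: e_def)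
  have es: "e * s a \<le> h" if "a < q" for a
  proof -
    have "s a \<le> (\<Sum>a<q. s a)" using that s by (intro member_le_sum) (auto simp: less_imp_le)
    then have "s a \<le> sm" by (simp add: sm_def)
    then show ?thesis using sm h by (simp add: e_def field_simps mult_left_mono)
  qed
  have tmi: "t i \<le> tm" if "i < p" for i
    unfolding tm_def using that t by (intro member_le_sum) (auto simp: less_imp_le)
  let ?Z' = "mat_adjoint Z"
  let ?S = "\<lambda>a. s a + h"
  define R where "R = Z * rdiag q (\<lambda>a. ?S a - K) * ?Z'"
  \<comment> \<open>\<open>M\<close> acts as \<open>s + h\<close> on the range of \<open>Z\<close> and as \<open>K\<close> on its orthogonal complement; the cross
    terms of \<open>diag t\<close> between the two are absorbed by \<open>\<bar>a + b\<bar>\<^sup>2 \<le> (1 + e) \<bar>a\<bar>\<^sup>2 + (1 + 1/e) \<bar>b\<bar>\<^sup>2\<close>.\<close>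
  define M where "M = complex_of_real K \<cdot>\<^sub>m 1\<^sub>m p + R"
  have Rc: "R \<in> carrier_mat p p" and Mc: "M \<in> carrier_mat p p" using Z by (auto simp: R_def M_def)
  have Z'c: "?Z' \<in> carrier_mat q p" using Z by auto
  have Mv: "M *\<^sub>v x = complex_of_real K \<cdot>\<^sub>v x + Z *\<^sub>v (rdiag q (\<lambda>a. ?S a - K) *\<^sub>v (?Z' *\<^sub>v x))"
    if x: "x \<in> carrier_vec p" for x
  proof -
    have "M *\<^sub>v x = (complex_of_real K \<cdot>\<^sub>m 1\<^sub>m p) *\<^sub>v x + R *\<^sub>v x"
      unfolding M_def using x Rc by (intro add_mult_distrib_mat_vec[of _ p p]) auto
    also have "(complex_of_real K \<cdot>\<^sub>m 1\<^sub>m p) *\<^sub>v x = complex_of_real K \<cdot>\<^sub>v x"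
      using x by (intro eq_vecI) auto
    also have "R *\<^sub>v x = Z *\<^sub>v (rdiag q (\<lambda>a. ?S a - K) *\<^sub>v (?Z' *\<^sub>v x))"
      unfolding R_def using x Z Z'c by (intro triple_mult_mat_vec[of _ p q _ q _ p]) auto
    finally show ?thesis .
  qed
  have Z'Z: "?Z' *\<^sub>v (Z *\<^sub>v v) = v" if "v \<in> carrier_vec q" for v
    using that Z Z'c by (simp add: assoc_mult_mat_vec[of _ q p _ q, symmetric])
  have iso: "(\<Sum>i<p. (cmod ((Z *\<^sub>v v) $ i))\<^sup>2) = (\<Sum>a<q. (cmod (v $ a))\<^sup>2)" if v: "v \<in> carrier_vec q" for v
  proof -
    have Zv: "Z *\<^sub>v v \<in> carrier_vec p" using Z v by auto
    have "(Z *\<^sub>v v) \<bullet>c (Z *\<^sub>v v) = v \<bullet>c v"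
      using cscalar_prod_adjoint[OF Z(1) v Zv] Z'Z[OF v] by simp
    then show ?thesis unfolding cscalar_prod_self[OF v] cscalar_prod_self[OF Zv] of_real_eq_iff .
  qed
  \<comment> \<open>\<open>y\<close> is the part of \<open>x\<close> orthogonal to the range of
    \<open>Z\<close>. Unlike \<open>diag t\<close>, the matrix \<open>M\<close> has no cross terms
    between the two parts, so its form splits exactly.\<close>
  have formM: "\<exists>y. (M *\<^sub>v x) \<bullet>c x = complex_of_real (\<Sum>a<q. ?S a * (cmod ((?Z' *\<^sub>v x) $ a))\<^sup>2) + complex_of_real (K * (\<Sum>i<p. (cmod (y $ i))\<^sup>2))
      \<and> y \<in> carrier_vec p \<and> x = Z *\<^sub>v (?Z' *\<^sub>v x) + y" if x: "x \<in> carrier_vec p" for x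
  proof -
    define v where "v = ?Z' *\<^sub>v x"
    have v: "v \<in> carrier_vec q" using x Z'c by (auto simp: v_def)
    have Zv: "Z *\<^sub>v v \<in> carrier_vec p" using Z v by auto
    define y where "y = x - Z *\<^sub>v v"
    have y: "y \<in> carrier_vec p" using x Zv by (auto simp: y_def)
    have xy: "x = Z *\<^sub>v v + y" unfolding y_def using x Zv Z by (intro eq_vecI) auto
    have "?Z' *\<^sub>v y = 0\<^sub>v q"
      unfolding y_def using x Zv Z'c v by (simp add: mult_minus_distrib_mat_vec[of _ q p] Z'Z v_def[symmetric])
    then have "(Z *\<^sub>v v) \<bullet>c y = 0"
      using cscalar_prod_adjoint[OF Z(1) v y] v by (simp add: scalar_prod_def)
    moreover have "y \<bullet>c (Z *\<^sub>v v) = 0"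
      using \<open>?Z' *\<^sub>v y = 0\<^sub>v q\<close> cscalar_prod_adjoint[OF Z'c y v] v by (simp add: scalar_prod_def)
    ultimately have "x \<bullet>c x = (Z *\<^sub>v v) \<bullet>c (Z *\<^sub>v v) + y \<bullet>c y"
      unfolding xy using y Zv
      by (simp add: add_scalar_prod_distrib[of _ p] scalar_prod_add_distrib[of _ p] conjugate_add_vec[of _ p])
    also have "\<dots> = complex_of_real ((\<Sum>a<q. (cmod (v $ a))\<^sup>2) + (\<Sum>i<p. (cmod (y $ i))\<^sup>2))"
      unfolding cscalar_prod_self[OF y] cscalar_prod_self[OF Zv] iso[OF v] by simp
    finally have xx: "x \<bullet>c x = complex_of_real ((\<Sum>a<q. (cmod (v $ a))\<^sup>2) + (\<Sum>i<p. (cmod (y $ i))\<^sup>2))" .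
    define Dv where "Dv = rdiag q (\<lambda>a. ?S a - K) *\<^sub>v v"
    have Dv: "Dv \<in> carrier_vec q" using v by (simp add: Dv_def rdiag_mult_vec)
    have "(M *\<^sub>v x) \<bullet>c x = complex_of_real K * (x \<bullet>c x) + (Z *\<^sub>v Dv) \<bullet>c x"
      unfolding Mv[OF x] v_def[symmetric] Dv_def[symmetric] using x Z Dv
      by (simp add: add_scalar_prod_distrib[of _ p])
    also have "(Z *\<^sub>v Dv) \<bullet>c x = Dv \<bullet>c v"
      using cscalar_prod_adjoint[OF Z(1) Dv x] by (simp add: v_def)
    also have "\<dots> = complex_of_real (\<Sum>a<q. (?S a - K) * (cmod (v $ a))\<^sup>2)"
      unfolding Dv_def by (rule rdiag_form[OF v])
    also have "(\<Sum>a<q. (?S a - K) * (cmod (v $ a))\<^sup>2) = (\<Sum>a<q. ?S a * (cmod (v $ a))\<^sup>2) - K * (\<Sum>a<q. (cmod (v $ a))\<^sup>2)"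
      by (simp add: sum_distrib_left sum_subtractf left_diff_distrib)
    finally have "(M *\<^sub>v x) \<bullet>c x = complex_of_real (\<Sum>a<q. ?S a * (cmod (v $ a))\<^sup>2) + complex_of_real (K * (\<Sum>i<p. (cmod (y $ i))\<^sup>2))"
      unfolding xx by (simp add: algebra_simps)
    then show ?thesis using y xy unfolding v_def by blast
  qed
  let ?T = "rdiag p t"
  have pdT: "pd_mat p ?T" by (rule pd_rdiag[OF t])
  have MT: "((M - ?T) *\<^sub>v x) \<bullet>c x = (M *\<^sub>v x) \<bullet>c x - (?T *\<^sub>v x) \<bullet>c x" if x: "x \<in> carrier_vec p" for x
    using Mc x by (simp add: minus_mult_distrib_mat_vec[of _ p p] minus_scalar_prod_distrib[of _ p]
       mult_mat_vec_carrier[of _ p p])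
  have psdMT: "((M - ?T) *\<^sub>v x) \<bullet>c x \<ge> 0" if x: "x \<in> carrier_vec p" for x
  proof -
    define v where "v = ?Z' *\<^sub>v x"
    have v: "v \<in> carrier_vec q" using x Z'c by (auto simp: v_def)
    have Zv: "Z *\<^sub>v v \<in> carrier_vec p" using Z v by auto
    obtain y where y: "(M *\<^sub>v x) \<bullet>c x = complex_of_real (\<Sum>a<q. ?S a * (cmod (v $ a))\<^sup>2) + complex_of_real (K * (\<Sum>i<p. (cmod (y $ i))\<^sup>2))"
      "y \<in> carrier_vec p" "x = Z *\<^sub>v v + y" using formM[OF x] unfolding v_def by blast
    have young: "(cmod (a + b))\<^sup>2 \<le> (1 + e) * (cmod a)\<^sup>2 + (1 + 1/e) * (cmod b)\<^sup>2" for a b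
    proof -
      have "(cmod (a + b))\<^sup>2 \<le> (cmod a + cmod b)\<^sup>2"
        by (intro power_mono norm_triangle_ineq) auto
      also have "\<dots> = (1 + e) * (cmod a)\<^sup>2 + (1 + 1/e) * (cmod b)\<^sup>2 - (e * cmod a - cmod b)\<^sup>2 / e"
        using e0 by (simp add: field_simps power2_eq_square)
      also have "\<dots> \<le> (1 + e) * (cmod a)\<^sup>2 + (1 + 1/e) * (cmod b)\<^sup>2"
        using e0 by simp
      finally show ?thesis .
    qed
    have "(\<Sum>i<p. t i * (cmod (x $ i))\<^sup>2) \<le> (\<Sum>i<p. t i * ((1 + e) * (cmod ((Z *\<^sub>v v) $ i))\<^sup>2 + (1 + 1/e) * (cmod (y $ i))\<^sup>2))"
    proof (rule sum_mono)
      fix i assume "i \<in> {..<p}"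
      then have i: "i < p" by simp
      have "x $ i = (Z *\<^sub>v v) $ i + y $ i" using i y(2) by (subst y(3)) auto
      then show "t i * (cmod (x $ i))\<^sup>2 \<le> t i * ((1 + e) * (cmod ((Z *\<^sub>v v) $ i))\<^sup>2 + (1 + 1/e) * (cmod (y $ i))\<^sup>2)"
        using young t[OF i] by (intro mult_left_mono) auto
    qed
    also have "\<dots> = (1 + e) * (\<Sum>i<p. t i * (cmod ((Z *\<^sub>v v) $ i))\<^sup>2) + (1 + 1/e) * (\<Sum>i<p. t i * (cmod (y $ i))\<^sup>2)"
      unfolding sum_distrib_left sum.distrib[symmetric] by (rule sum.cong) (simp_all add: ring_distribs)
    also have "\<dots> \<le> (1 + e) * (\<Sum>a<q. s a * (cmod (v $ a))\<^sup>2) + (1 + 1/e) * (\<Sum>i<p. tm * (cmod (y $ i))\<^sup>2)"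
      using e0 le[OF v] tmi by (intro add_mono mult_left_mono sum_mono mult_right_mono) auto
    also have "(1 + e) * (\<Sum>a<q. s a * (cmod (v $ a))\<^sup>2) \<le> (\<Sum>a<q. ?S a * (cmod (v $ a))\<^sup>2)"
      unfolding sum_distrib_left
    proof (rule sum_mono)
      fix a assume "a \<in> {..<q}"
      then have "(1 + e) * s a \<le> ?S a" using es by (simp add: algebra_simps)
      then have "(1 + e) * s a * (cmod (v $ a))\<^sup>2 \<le> ?S a * (cmod (v $ a))\<^sup>2" by (rule mult_right_mono) simp
      then show "(1 + e) * (s a * (cmod (v $ a))\<^sup>2) \<le> ?S a * (cmod (v $ a))\<^sup>2" by (simp add: mult.assoc)
    qed
    also have "(1 + 1/e) * (\<Sum>i<p. tm * (cmod (y $ i))\<^sup>2) = K * (\<Sum>i<p. (cmod (y $ i))\<^sup>2)"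
      by (simp add: K_def sum_distrib_left mult.assoc)
    finally show ?thesis unfolding MT[OF x] y(1) rdiag_form[OF x]
      by (simp add: less_eq_complex_def)
  qed
  have leTM: "mat_le p ?T M" unfolding mat_le_def psd_mat_def using psdMT Mc by (auto intro: minus_carrier_mat)
  have pdM: "pd_mat p M" unfolding pd_mat_def
  proof (intro conjI ballI impI Mc)
    fix x :: "complex vec" assume x: "x \<in> carrier_vec p" "x \<noteq> 0\<^sub>v p"
    then have "0 < (?T *\<^sub>v x) \<bullet>c x" using pdT unfolding pd_mat_def by blast
    also have "\<dots> \<le> (M *\<^sub>v x) \<bullet>c x" using psdMT[OF x(1)] unfolding MT[OF x(1)] by simp
    finally show "0 < (M *\<^sub>v x) \<bullet>c x" .
  qed
  define G where "G = mat_fun p f M"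
  note psdM = pd_mat_imp_psd[OF pdM]
  have Gc: "G \<in> carrier_mat p p" unfolding G_def by (rule mat_fun_eigenvector[OF psdM])
  let ?D = "rdiag q (\<lambda>a. f (?S a))"
  \<comment> \<open>\<open>G\<close> is accessible only through eigenvectors of \<open>M\<close>.
    The columns of \<open>Z\<close> are such eigenvectors, and they determine \<open>f(M)\<close> on
    the range of \<open>Z\<close>, where the inequality is going to be tested.\<close>
  have GZ: "G * Z = Z * ?D"
  proof (rule eq_mat_colI)
    show "G * Z \<in> carrier_mat p q" "Z * ?D \<in> carrier_mat p q" using Gc Z by auto
    fix a assume a: "a < q"
    have Za: "Z *\<^sub>v unit_vec q a = col Z a" using Z a by (intro eq_vecI) auto
    have ca: "col Z a \<in> carrier_vec p" using Z by auto
    have Z'a: "?Z' *\<^sub>v col Z a = unit_vec q a" using Z'Z[of "unit_vec q a"] Za by simp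
    have ev: "eigenvector M (col Z a) (complex_of_real (?S a))"
      unfolding eigenvector_def
    proof (intro conjI)
      show "col Z a \<in> carrier_vec (dim_row M)" using ca Mc by simp
      show "col Z a \<noteq> 0\<^sub>v (dim_row M)"
      proof
        assume "col Z a = 0\<^sub>v (dim_row M)"
        then have "unit_vec q a = (0\<^sub>v q :: complex vec)"
          unfolding Z'a[symmetric] using Z'c Mc by (intro eq_vecI) (auto simp: scalar_prod_def)
        then show False using a by simp
      qed
      have "M *\<^sub>v col Z a = complex_of_real K \<cdot>\<^sub>v col Z a + Z *\<^sub>v (complex_of_real (?S a - K) \<cdot>\<^sub>v unit_vec q a)"
        unfolding Mv[OF ca] Z'a using a by (simp add: mult_mat_vec_unit rdiag_col)
      also have "\<dots> = complex_of_real K \<cdot>\<^sub>v col Z a + complex_of_real (?S a - K) \<cdot>\<^sub>v col Z a"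
        using Z Za by (simp add: mult_mat_vec[of Z p q])
      also have "\<dots> = complex_of_real (?S a) \<cdot>\<^sub>v col Z a"
        using ca by (intro eq_vecI) (auto simp: algebra_simps)
      finally show "M *\<^sub>v col Z a = complex_of_real (?S a) \<cdot>\<^sub>v col Z a" .
    qed
    have "col (G * Z) a = G *\<^sub>v col Z a" by (rule col_mult2[OF Gc Z(1) a])
    also have "\<dots> = complex_of_real (f (?S a)) \<cdot>\<^sub>v col Z a"
      using mat_fun_eigenvector(2)[OF psdM ev, of f] by (simp add: G_def)
    also have "\<dots> = Z *\<^sub>v (complex_of_real (f (?S a)) \<cdot>\<^sub>v unit_vec q a)"
      using Z Za by (simp add: mult_mat_vec[of Z p q])
    also have "\<dots> = col (Z * ?D) a" using Z a by (simp add: rdiag_col col_mult2[of Z p q ?D q])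
    finally show "col (G * Z) a = col (Z * ?D) a" .
  qed
  have Zu: "Z *\<^sub>v u \<in> carrier_vec p" using Z u by auto
  have "mat_le p (mat_fun p f ?T) G" using f pdT pdM leTM unfolding op_monotone_def G_def by blast
  moreover have "mat_fun p f ?T = rdiag p (f \<circ> t)" using t by (rule mat_fun_rdiag)
  ultimately have "psd_mat p (G - rdiag p (f \<circ> t))" by (simp add: mat_le_def)
  then have "((G - rdiag p (f \<circ> t)) *\<^sub>v (Z *\<^sub>v u)) \<bullet>c (Z *\<^sub>v u) \<ge> 0"
    using Zu unfolding psd_mat_def by blast
  moreover have "((G - rdiag p (f \<circ> t)) *\<^sub>v (Z *\<^sub>v u)) \<bullet>c (Z *\<^sub>v u)
     = (G *\<^sub>v (Z *\<^sub>v u)) \<bullet>c (Z *\<^sub>v u) - (rdiag p (f \<circ> t) *\<^sub>v (Z *\<^sub>v u)) \<bullet>c (Z *\<^sub>v u)"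
    using Gc Zu by (simp add: minus_mult_distrib_mat_vec[of _ p p] minus_scalar_prod_distrib[of _ p]
       mult_mat_vec_carrier[of _ p p])
  moreover have "(G *\<^sub>v (Z *\<^sub>v u)) \<bullet>c (Z *\<^sub>v u) = complex_of_real (\<Sum>a<q. f (?S a) * (cmod (u $ a))\<^sup>2)"
  proof -
    have Du: "?D *\<^sub>v u \<in> carrier_vec q" using u by (simp add: rdiag_mult_vec)
    have "G *\<^sub>v (Z *\<^sub>v u) = (G * Z) *\<^sub>v u" using Gc Z u by (simp add: assoc_mult_mat_vec[of G p p Z q])
    also have "\<dots> = Z *\<^sub>v (?D *\<^sub>v u)" unfolding GZ using Z u by (simp add: assoc_mult_mat_vec[of Z p q ?D q])
    finally have "(G *\<^sub>v (Z *\<^sub>v u)) \<bullet>c (Z *\<^sub>v u) = (?D *\<^sub>v u) \<bullet>c u"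
      using cscalar_prod_adjoint[OF Z(1) Du Zu] Z'Z[OF u] by simp
    then show ?thesis using rdiag_form[OF u, of "\<lambda>a. f (?S a)"] by simp
  qed
  ultimately show ?thesis unfolding rdiag_form[OF Zu] by (simp add: less_eq_complex_def)
qed

lemma sum_lessThan_split:
  fixes g :: "nat \<Rightarrow> 'a::comm_monoid_add"
  shows "(\<Sum>i<p + q. g i) = (\<Sum>i<p. g i) + (\<Sum>i<q. g (p + i))"
  by (induction q) (auto simp: add.assoc)

lemma op_monotone_contraction_vec:
  assumes f: "op_monotone f" "\<And>x. x > 0 \<Longrightarrow> f x \<ge> 0"
    and W: "W \<in> carrier_mat p q"
    and contr: "\<And>u. u \<in> carrier_vec q \<Longrightarrow>
      (\<Sum>i<p. (cmod ((W *\<^sub>v u) $ i))\<^sup>2) \<le> (\<Sum>a<q. (cmod (u $ a))\<^sup>2)"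
    and t: "\<And>i. i < p \<Longrightarrow> t i > 0" and s: "\<And>a. a < q \<Longrightarrow> s a > 0" and h: "h > 0"
    and le: "\<And>u. u \<in> carrier_vec q \<Longrightarrow>
      (\<Sum>i<p. t i * (cmod ((W *\<^sub>v u) $ i))\<^sup>2) \<le> (\<Sum>a<q. s a * (cmod (u $ a))\<^sup>2)"
    and u: "u \<in> carrier_vec q"
  shows "(\<Sum>i<p. f (t i) * (cmod ((W *\<^sub>v u) $ i))\<^sup>2) \<le> (\<Sum>a<q. f (s a + h) * (cmod (u $ a))\<^sup>2)"
proof -
  let ?W' = "mat_adjoint W"
  have W'c: "?W' \<in> carrier_mat q p" and WWc: "?W' * W \<in> carrier_mat q q" using W by auto
  have defect: "((1\<^sub>m q - ?W' * W) *\<^sub>v v) \<bullet>c v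
      = complex_of_real ((\<Sum>a<q. (cmod (v $ a))\<^sup>2) - (\<Sum>i<p. (cmod ((W *\<^sub>v v) $ i))\<^sup>2))"
    if v: "v \<in> carrier_vec q" for v
  proof -
    have Wv: "W *\<^sub>v v \<in> carrier_vec p" using W v by auto
    have W'Wv: "?W' *\<^sub>v (W *\<^sub>v v) \<in> carrier_vec q" using W'c Wv by auto
    have "(1\<^sub>m q - ?W' * W) *\<^sub>v v = v - ?W' *\<^sub>v (W *\<^sub>v v)"
      using v W W'c WWc by (simp add: minus_mult_distrib_mat_vec[of _ q q] assoc_mult_mat_vec[of _ q p _ q])
    then have "((1\<^sub>m q - ?W' * W) *\<^sub>v v) \<bullet>c v = v \<bullet>c v - (?W' *\<^sub>v (W *\<^sub>v v)) \<bullet>c v"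
      using v W'Wv by (simp add: minus_scalar_prod_distrib[of _ q])
    also have "(?W' *\<^sub>v (W *\<^sub>v v)) \<bullet>c v = (W *\<^sub>v v) \<bullet>c (W *\<^sub>v v)"
      using cscalar_prod_adjoint[OF W'c Wv v] by simp
    finally show ?thesis unfolding cscalar_prod_self[OF v] cscalar_prod_self[OF Wv] by simp
  qed
  have "psd_mat q (1\<^sub>m q - ?W' * W)"
    unfolding psd_mat_def using contr WWc by (auto simp: defect less_eq_complex_def intro: minus_carrier_mat)
  then obtain V d where V: "unitary_mat q V" and d: "1\<^sub>m q - ?W' * W = V * rdiag q d * mat_adjoint V"
    "\<And>i. i < q \<Longrightarrow> d i \<ge> 0" using psd_mat_spectral by metis
  note Vc = unitary_matD[OF V]
  \<comment> \<open>The defect operator: stacking \<open>W\<close> on \<open>N\<close> gives an isometry.\<close>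
  define N where "N = rdiag q (\<lambda>i. sqrt (d i)) * mat_adjoint V"
  have Nc: "N \<in> carrier_mat q q" unfolding N_def using Vc by (intro mult_carrier_mat[of _ q q]) auto
  have N'N: "mat_adjoint N * N = 1\<^sub>m q - ?W' * W"
  proof -
    let ?r = "rdiag q (\<lambda>i. sqrt (d i))"
    have r: "mat_adjoint ?r = ?r" by (rule eq_matI) (auto simp: rdiag_def)
    have rr: "?r * ?r = rdiag q d"
    proof (rule eq_mat_colI)
      fix j assume j: "j < q"
      have "col (?r * ?r) j = ?r *\<^sub>v (complex_of_real (sqrt (d j)) \<cdot>\<^sub>v unit_vec q j)"
        using j by (simp add: col_mult2[of _ q q _ q] rdiag_col)
      also have "\<dots> = complex_of_real (sqrt (d j)) \<cdot>\<^sub>v (complex_of_real (sqrt (d j)) \<cdot>\<^sub>v unit_vec q j)"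
        using j by (simp add: mult_mat_vec[of _ q q] mult_mat_vec_unit rdiag_col)
      also have "\<dots> = col (rdiag q d) j"
        using j d(2)[OF j] by (simp add: rdiag_col smult_smult_assoc flip: of_real_mult)
      finally show "col (?r * ?r) j = col (rdiag q d) j" .
    qed (auto intro: mult_carrier_mat)
    have "mat_adjoint N * N = V * (?r * ?r) * mat_adjoint V"
      unfolding N_def using Vc r
      by (simp add: mat_adjoint_mult[of _ q q _ q] assoc_mult_mat[of _ q q _ q _ q] mult_carrier_mat[of _ q q])
    then show ?thesis unfolding rr d(1) .
  qed
  define Z where "Z = mat (p + q) q (\<lambda>(i,a). if i < p then W $$ (i,a) else N $$ (i - p, a))"
  have Zc: "Z \<in> carrier_mat (p + q) q" by (simp add: Z_def)
  have Zv: "(Z *\<^sub>v v) $ i = (W *\<^sub>v v) $ i" if "v \<in> carrier_vec q" "i < p" for v i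
    using that W Zc by (auto simp: Z_def scalar_prod_def)
  have Zv': "(Z *\<^sub>v v) $ (p + i) = (N *\<^sub>v v) $ i" if "v \<in> carrier_vec q" "i < q" for v i
    using that Nc Zc by (auto simp: Z_def scalar_prod_def)
  have Z'Z: "mat_adjoint Z * Z = 1\<^sub>m q"
  proof (rule eq_matI)
    fix a b assume "a < dim_row (1\<^sub>m q :: complex mat)" "b < dim_col (1\<^sub>m q :: complex mat)"
    then have ab: "a < q" "b < q" by auto
    have "(mat_adjoint Z * Z) $$ (a,b) = (\<Sum>i<p + q. cnj (Z $$ (i,a)) * Z $$ (i,b))"
      using ab Zc by (simp add: scalar_prod_def lessThan_atLeast0)
    also have "\<dots> = (\<Sum>i<p. cnj (W $$ (i,a)) * W $$ (i,b)) + (\<Sum>i<q. cnj (N $$ (i,a)) * N $$ (i,b))"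
      unfolding sum_lessThan_split using ab by (simp add: Z_def)
    also have "\<dots> = (?W' * W) $$ (a,b) + (mat_adjoint N * N) $$ (a,b)"
      using ab W Nc by (simp add: scalar_prod_def lessThan_atLeast0)
    also have "\<dots> = 1\<^sub>m q $$ (a,b)" unfolding N'N using ab W by simp
    finally show "(mat_adjoint Z * Z) $$ (a,b) = 1\<^sub>m q $$ (a,b)" .
  qed (use Zc in auto)
  have Nle: "(\<Sum>i<q. (cmod ((N *\<^sub>v v) $ i))\<^sup>2) \<le> (\<Sum>a<q. (cmod (v $ a))\<^sup>2)" if v: "v \<in> carrier_vec q" for v
  proof -
    have Nv: "N *\<^sub>v v \<in> carrier_vec q" using Nc v by auto
    have "complex_of_real (\<Sum>i<q. (cmod ((N *\<^sub>v v) $ i))\<^sup>2) = (N *\<^sub>v v) \<bullet>c (N *\<^sub>v v)"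
      by (simp add: cscalar_prod_self[OF Nv])
    also have "\<dots> = (mat_adjoint N *\<^sub>v (N *\<^sub>v v)) \<bullet>c v"
      using cscalar_prod_adjoint[of "mat_adjoint N" q q "N *\<^sub>v v" v] Nc Nv v by auto
    also have "mat_adjoint N *\<^sub>v (N *\<^sub>v v) = (1\<^sub>m q - ?W' * W) *\<^sub>v v"
      unfolding N'N[symmetric] using Nc v by (simp add: assoc_mult_mat_vec[of _ q q _ q])
    finally have "(\<Sum>i<q. (cmod ((N *\<^sub>v v) $ i))\<^sup>2) = (\<Sum>a<q. (cmod (v $ a))\<^sup>2) - (\<Sum>i<p. (cmod ((W *\<^sub>v v) $ i))\<^sup>2)"
      unfolding defect[OF v] of_real_eq_iff .
    then show ?thesis by (simp add: sum_nonneg)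
  qed
  \<comment> \<open>The defect block gets \<open>h / 2\<close> rather than 0, so that the padded
    diagonal stays positive definite. By \<open>Nle\<close> this costs at most \<open>h / 2\<close>
    on the right-hand side; the other \<open>h / 2\<close> is the slack of the isometric
    case.\<close>
  define t' where "t' i = (if i < p then t i else h / 2)" for i
  have le': "(\<Sum>i<p + q. t' i * (cmod ((Z *\<^sub>v v) $ i))\<^sup>2) \<le> (\<Sum>a<q. (s a + h / 2) * (cmod (v $ a))\<^sup>2)"
    if v: "v \<in> carrier_vec q" for v
  proof -
    have "(\<Sum>i<p + q. t' i * (cmod ((Z *\<^sub>v v) $ i))\<^sup>2)
      = (\<Sum>i<p. t i * (cmod ((W *\<^sub>v v) $ i))\<^sup>2) + h / 2 * (\<Sum>i<q. (cmod ((N *\<^sub>v v) $ i))\<^sup>2)"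
      unfolding sum_lessThan_split using v by (simp add: t'_def Zv Zv' sum_distrib_left)
    also have "\<dots> \<le> (\<Sum>a<q. s a * (cmod (v $ a))\<^sup>2) + h / 2 * (\<Sum>a<q. (cmod (v $ a))\<^sup>2)"
      using le[OF v] Nle[OF v] h by (intro add_mono mult_left_mono) auto
    also have "\<dots> = (\<Sum>a<q. (s a + h / 2) * (cmod (v $ a))\<^sup>2)"
      by (simp add: sum_distrib_left sum.distrib distrib_right)
    finally show ?thesis .
  qed
  \<comment> \<open>Nonnegativity of \<open>f\<close> is what permits a contraction in place of an
    isometry: the contribution of the defect block may be added on the left.\<close>
  have "(\<Sum>i<p. f (t i) * (cmod ((W *\<^sub>v u) $ i))\<^sup>2)
      \<le> (\<Sum>i<p. f (t i) * (cmod ((W *\<^sub>v u) $ i))\<^sup>2) + (\<Sum>i<q. f (h / 2) * (cmod ((N *\<^sub>v u) $ i))\<^sup>2)"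
    using f(2)[of "h / 2"] h by (simp add: sum_nonneg)
  also have "\<dots> = (\<Sum>i<p + q. f (t' i) * (cmod ((Z *\<^sub>v u) $ i))\<^sup>2)"
    unfolding sum_lessThan_split using u by (simp add: t'_def Zv Zv')
  also have "\<dots> \<le> (\<Sum>a<q. f (s a + h / 2 + h / 2) * (cmod (u $ a))\<^sup>2)"
    by (rule op_monotone_isometry[OF f(1) Zc Z'Z _ _ _ le' u])
      (use h t s in \<open>auto simp: t'_def add_pos_pos\<close>)
  finally show ?thesis by (simp add: add.assoc)
qed

text \<open>Arbitrary finite index sets serve the two uses of the inequality: \<open>bool\<close>
  and \<open>unit\<close> for the midpoint inequality, and index pairs for operators on matrix
  spaces.\<close>

lemma op_monotone_contraction:
  fixes w :: "'i \<Rightarrow> 'j \<Rightarrow> complex"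
  assumes f: "op_monotone f" "\<And>x. x > 0 \<Longrightarrow> f x \<ge> 0" and fin: "finite I" "finite J"
    and contr: "\<And>u. (\<Sum>i\<in>I. (cmod (\<Sum>a\<in>J. w i a * u a))\<^sup>2) \<le> (\<Sum>a\<in>J. (cmod (u a))\<^sup>2)"
    and t: "\<And>i. i \<in> I \<Longrightarrow> t i > 0" and s: "\<And>a. a \<in> J \<Longrightarrow> s a > 0" and h: "h > 0"
    and le: "\<And>u. (\<Sum>i\<in>I. t i * (cmod (\<Sum>a\<in>J. w i a * u a))\<^sup>2) \<le> (\<Sum>a\<in>J. s a * (cmod (u a))\<^sup>2)"
  shows "(\<Sum>i\<in>I. f (t i) * (cmod (\<Sum>a\<in>J. w i a * u a))\<^sup>2) \<le> (\<Sum>a\<in>J. f (s a + h) * (cmod (u a))\<^sup>2)"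
proof -
  obtain \<alpha> where \<alpha>: "bij_betw \<alpha> {..<card I} I"
    using ex_bij_betw_nat_finite[OF fin(1)] by (auto simp: lessThan_atLeast0)
  obtain \<beta> where \<beta>: "bij_betw \<beta> {..<card J} J"
    using ex_bij_betw_nat_finite[OF fin(2)] by (auto simp: lessThan_atLeast0)
  let ?p = "card I" and ?q = "card J"
  have \<alpha>I: "\<alpha> i \<in> I" if "i < ?p" for i using \<alpha> that by (auto simp: bij_betw_def)
  have \<beta>J: "\<beta> i \<in> J" if "i < ?q" for i using \<beta> that by (auto simp: bij_betw_def)
  note rI = sum.reindex_bij_betw[OF \<alpha>, symmetric]
  note rJ = sum.reindex_bij_betw[OF \<beta>, symmetric]
  define W where "W = mat ?p ?q (\<lambda>(i,a). w (\<alpha> i) (\<beta> a))"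
  have Wc: "W \<in> carrier_mat ?p ?q" by (simp add: W_def)
  have W: "(W *\<^sub>v v) $ i = (\<Sum>a\<in>J. w (\<alpha> i) a * x a)"
    if "v \<in> carrier_vec ?q" "i < ?p" "\<And>a. a < ?q \<Longrightarrow> x (\<beta> a) = v $ a" for v i x
    using that unfolding rJ by (simp add: W_def scalar_prod_def lessThan_atLeast0)
  \<comment> \<open>\<open>x v\<close> transports the vector \<open>v\<close> to the index set
    \<open>J\<close> along \<open>\<beta>\<close>.\<close>
  define x where "x v b = v $ (the_inv_into {..<?q} \<beta> b)" for v :: "complex vec" and b
  have x: "x v (\<beta> a) = v $ a" if "a < ?q" for v a
    unfolding x_def using \<beta> that by (simp add: the_inv_into_f_f bij_betw_def)
  let ?u = "vec ?q (\<lambda>a. u (\<beta> a))"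
  have "(\<Sum>i<?p. f (t (\<alpha> i)) * (cmod ((W *\<^sub>v ?u) $ i))\<^sup>2)
      \<le> (\<Sum>a<?q. f (s (\<beta> a) + h) * (cmod (?u $ a))\<^sup>2)"
  proof (rule op_monotone_contraction_vec[OF f Wc])
    fix v :: "complex vec" assume v: "v \<in> carrier_vec ?q"
    show "(\<Sum>i<?p. (cmod ((W *\<^sub>v v) $ i))\<^sup>2) \<le> (\<Sum>a<?q. (cmod (v $ a))\<^sup>2)"
      using contr[of "x v"] unfolding rI unfolding rJ[of "\<lambda>a. (cmod (x v a))\<^sup>2"]
      by (simp add: W[OF v _ x] x)
    show "(\<Sum>i<?p. t (\<alpha> i) * (cmod ((W *\<^sub>v v) $ i))\<^sup>2) \<le> (\<Sum>a<?q. s (\<beta> a) * (cmod (v $ a))\<^sup>2)"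
      using le[of "x v"] unfolding rI unfolding rJ[of "\<lambda>a. s a * (cmod (x v a))\<^sup>2"]
      by (simp add: W[OF v _ x] x)
  qed (use h t s \<alpha>I \<beta>J in auto)
  moreover have "(W *\<^sub>v ?u) $ i = (\<Sum>a\<in>J. w (\<alpha> i) a * u a)" if "i < ?p" for i
    using that by (intro W) auto
  ultimately show ?thesis
    unfolding rI unfolding rJ[of "\<lambda>a. f (s a + h) * (cmod (u a))\<^sup>2"] by simp
qed

section \<open>Scalar consequences: monotonicity, midpoint concavity, right continuity\<close>

lemma op_monotone_mono:
  assumes f: "op_monotone f" and "0 < x" "x \<le> y"
  shows "f x \<le> f y"
proof -
  have c: "mat_le 1 (rdiag 1 (\<lambda>_. a)) (rdiag 1 (\<lambda>_. b)) \<longleftrightarrow> a \<le> b" for a b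
  proof
    assume "a \<le> b"
    have "rdiag 1 (\<lambda>_. b) - rdiag 1 (\<lambda>_. a) = rdiag 1 (\<lambda>_. b - a)" by (rule eq_matI) (auto simp: rdiag_def)
    then show "mat_le 1 (rdiag 1 (\<lambda>_. a)) (rdiag 1 (\<lambda>_. b))"
      using \<open>a \<le> b\<close> by (simp add: mat_le_def psd_mat_def rdiag_form less_eq_complex_def)
  next
    assume "mat_le 1 (rdiag 1 (\<lambda>_. a)) (rdiag 1 (\<lambda>_. b))"
    moreover have "rdiag 1 (\<lambda>_. b) - rdiag 1 (\<lambda>_. a) = rdiag 1 (\<lambda>_. b - a)" by (rule eq_matI) (auto simp: rdiag_def)
    ultimately have "(rdiag 1 (\<lambda>_. b - a) *\<^sub>v unit_vec 1 0) \<bullet>c unit_vec 1 0 \<ge> 0"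
      unfolding mat_le_def psd_mat_def by simp
    then show "a \<le> b" by (subst (asm) rdiag_form) (auto simp: less_eq_complex_def)
  qed
  have "mat_le 1 (mat_fun 1 f (rdiag 1 (\<lambda>_. x))) (mat_fun 1 f (rdiag 1 (\<lambda>_. y)))"
    using f pd_rdiag[of 1 "\<lambda>_. x"] pd_rdiag[of 1 "\<lambda>_. y"] c[of x y] assms(2,3) unfolding op_monotone_def by auto
  then show ?thesis using assms(2,3) c[of "f x" "f y"] by (simp add: mat_fun_rdiag o_def)
qed

text \<open>Compress \<open>diag(x, y)\<close> by the isometry from one dimension to two with both
  entries \<open>1 / sqrt 2\<close>: the result is the mean \<open>(x + y) / 2\<close>. The strict
  gap between the mean and \<open>z\<close> is the slack.\<close>

lemma op_monotone_midpoint: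
  assumes f: "op_monotone f" "\<And>x. x > 0 \<Longrightarrow> f x \<ge> 0" and "0 < x" "0 < y" "(x + y) / 2 < z"
  shows "f x + f y \<le> 2 * f z"
proof -
  define t where "t i = (if i then x else y)" for i :: bool
  define w where "w i a = complex_of_real (sqrt (1/2))" for i :: bool and a :: unit
  have w: "(cmod (w i a * v))\<^sup>2 = (cmod v)\<^sup>2 / 2" for i a v
    by (simp add: w_def norm_mult norm_divide power_mult_distrib real_sqrt_divide power_divide)
  have "(\<Sum>i\<in>UNIV. f (t i) * (cmod (\<Sum>a\<in>UNIV. w i a * (1::complex)))\<^sup>2)
      \<le> (\<Sum>a\<in>(UNIV::unit set). f ((x + y) / 2 + (z - (x + y) / 2)) * (cmod 1)\<^sup>2)"
  proof (rule op_monotone_contraction[OF f])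
    fix u :: "unit \<Rightarrow> complex"
    show "(\<Sum>i\<in>UNIV. (cmod (\<Sum>a\<in>UNIV. w i a * u a))\<^sup>2) \<le> (\<Sum>a\<in>UNIV. (cmod (u a))\<^sup>2)"
      by (simp add: UNIV_bool UNIV_unit w)
    show "(\<Sum>i\<in>UNIV. t i * (cmod (\<Sum>a\<in>UNIV. w i a * u a))\<^sup>2) \<le> (\<Sum>a\<in>UNIV. (x + y) / 2 * (cmod (u a))\<^sup>2)"
      by (simp add: UNIV_bool UNIV_unit w t_def distrib_right add_divide_distrib)
  qed (use assms in \<open>auto simp: t_def\<close>)
  moreover have "(cmod (w i a))\<^sup>2 = 1 / 2" for i a using w[of i a 1] by simp
  ultimately show ?thesis by (simp add: UNIV_bool t_def UNIV_unit)
qed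

text \<open>By the midpoint inequality a jump of size \<open>e\<close> at \<open>s\<close> forces an increase of at least \<open>e\<close> on each
  interval \<open>[s - 4h, s - h]\<close>, so that \<open>f\<close> would be unbounded below \<open>s\<close>.\<close>

lemma op_monotone_right_continuous:
  assumes f: "op_monotone f" "\<And>x. x > 0 \<Longrightarrow> f x \<ge> 0" and s: "0 < s" and e: "0 < e"
  obtains h where "h > 0" "f (s + h) < f s + e"
proof -
  have "\<exists>h>0. f (s + h) < f s + e"
  proof (rule ccontr)
    assume "\<not> (\<exists>h>0. f (s + h) < f s + e)"
    then have jump: "f (s + h) \<ge> f s + e" if "h > 0" for h using that by (meson not_less)
    \<comment> \<open>The midpoint of \<open>s - 4 * h\<close> and \<open>s + h\<close> is
      \<open>s - 3 * h / 2\<close>, strictly below \<open>s - h\<close>, as the midpoint inequality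
      with slack requires.\<close>
    have step: "f (s - h) \<ge> f (s - 4 * h) + e" if h: "0 < h" "4 * h < s" for h
    proof -
      have "f (s - 4 * h) + f (s + h) \<le> 2 * f (s - h)"
        using h s by (intro op_monotone_midpoint[OF f]) auto
      moreover have "f (s - h) \<le> f s" using h s by (intro op_monotone_mono[OF f(1)]) auto
      ultimately show ?thesis using jump[OF h(1)] by linarith
    qed
    have it: "f (s - h) \<ge> real k * e" if "0 < h" "4 ^ k * h < s" for h k
      using that
    proof (induction k arbitrary: h)
      case 0
      then show ?case using f(2)[of "s - h"] by simp
    next
      case (Suc k)
      have "1 * h \<le> 4 ^ k * h" using Suc.prems(1) by (intro mult_right_mono) auto
      then have "4 * h < s" using Suc.prems(2) by (simp add: mult.assoc)
      from step[OF Suc.prems(1) this] have "f (s - h) \<ge> f (s - 4 * h) + e" .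
      moreover have "f (s - 4 * h) \<ge> real k * e" using Suc.prems by (intro Suc.IH) (auto simp: mult.assoc mult.left_commute)
      ultimately show ?case by (simp add: algebra_simps)
    qed
    obtain k where k: "f s < real k * e" using reals_Archimedean3[OF e] by blast
    \<comment> \<open>The distance to \<open>s\<close> quadruples at each of the \<open>k\<close>
      steps; starting here it ends at \<open>s / 2\<close>, so all arguments of \<open>f\<close>
      remain positive.\<close>
    define h where "h = s / (2 * 4 ^ k)"
    have h: "0 < h" "4 ^ k * h < s" using s by (auto simp: h_def)
    have "1 * h \<le> 4 ^ k * h" using h(1) by (intro mult_right_mono) auto
    then have "h < s" using h(2) by simp
    then have "f (s - h) \<le> f s" using h s by (intro op_monotone_mono[OF f(1)]) auto
    then show False using it[OF h] k by linarith
  qed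
  then show thesis using that by blast
qed

section \<open>Hansen's inequality without slack, and its weighted form\<close>

text \<open>Only the finitely many points \<open>s a\<close> matter, so right continuity there
  provides one slack \<open>h\<close> that is good for all of them.\<close>

theorem hansen_inequality:
  fixes w :: "'i \<Rightarrow> 'j \<Rightarrow> complex"
  assumes f: "op_monotone f" "\<And>x. x > 0 \<Longrightarrow> f x \<ge> 0" and fin: "finite I" "finite J"
    and contr: "\<And>u. (\<Sum>i\<in>I. (cmod (\<Sum>a\<in>J. w i a * u a))\<^sup>2) \<le> (\<Sum>a\<in>J. (cmod (u a))\<^sup>2)"
    and t: "\<And>i. i \<in> I \<Longrightarrow> t i > 0" and s: "\<And>a. a \<in> J \<Longrightarrow> s a > 0"
    and le: "\<And>u. (\<Sum>i\<in>I. t i * (cmod (\<Sum>a\<in>J. w i a * u a))\<^sup>2) \<le> (\<Sum>a\<in>J. s a * (cmod (u a))\<^sup>2)"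
  shows "(\<Sum>i\<in>I. f (t i) * (cmod (\<Sum>a\<in>J. w i a * u a))\<^sup>2) \<le> (\<Sum>a\<in>J. f (s a) * (cmod (u a))\<^sup>2)"
proof (rule field_le_epsilon)
  fix e :: real assume e: "e > 0"
  define S where "S = (\<Sum>a\<in>J. (cmod (u a))\<^sup>2)"
  have S: "S \<ge> 0" by (simp add: S_def sum_nonneg)
  define \<delta> where "\<delta> = e / (1 + S)"
  have \<delta>: "\<delta> > 0" using e S by (simp add: \<delta>_def)
  have "\<exists>h>0. f (s a + h) < f (s a) + \<delta>" if "a \<in> J" for a
    using op_monotone_right_continuous[OF f s[OF that] \<delta>] by blast
  then obtain g where g: "\<And>a. a \<in> J \<Longrightarrow> g a > 0 \<and> f (s a + g a) < f (s a) + \<delta>" by metis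
  \<comment> \<open>The inserted 1 makes the minimum meaningful for empty \<open>J\<close>.\<close>
  define h where "h = Min (insert 1 (g ` J))"
  have h: "h > 0" using fin g by (auto simp: h_def)
  have hg: "h \<le> g a" if "a \<in> J" for a using that fin by (simp add: h_def)
  have "(\<Sum>i\<in>I. f (t i) * (cmod (\<Sum>a\<in>J. w i a * u a))\<^sup>2) \<le> (\<Sum>a\<in>J. f (s a + h) * (cmod (u a))\<^sup>2)"
    by (rule op_monotone_contraction[OF f fin contr t s h le])
  also have "\<dots> \<le> (\<Sum>a\<in>J. (f (s a) + \<delta>) * (cmod (u a))\<^sup>2)"
  proof (intro sum_mono mult_right_mono)
    fix a assume a: "a \<in> J"
    have "f (s a + h) \<le> f (s a + g a)"
      using hg[OF a] h s[OF a] by (intro op_monotone_mono[OF f(1)]) auto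
    then show "f (s a + h) \<le> f (s a) + \<delta>" using g[OF a] by linarith
  qed simp
  also have "\<dots> = (\<Sum>a\<in>J. f (s a) * (cmod (u a))\<^sup>2) + \<delta> * S"
    by (simp add: S_def sum_distrib_left sum.distrib distrib_right)
  also have "\<delta> * S \<le> e" using e S by (simp add: \<delta>_def field_simps)
  finally show "(\<Sum>i\<in>I. f (t i) * (cmod (\<Sum>a\<in>J. w i a * u a))\<^sup>2) \<le> (\<Sum>a\<in>J. f (s a) * (cmod (u a))\<^sup>2) + e" by simp
qed

text \<open>\<open>w\<close> is \<open>V\<close> with rows scaled by \<open>sqrt (\<mu> i)\<close>
  and columns by \<open>1 / sqrt (c a)\<close>. Left and right multiplications commute, so both
  weights are diagonal in the same coordinates, and dividing by one turns the other into the plain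
  quotients \<open>\<kappa> i / \<mu> i\<close> and \<open>d a / c a\<close>.\<close>

theorem hansen_perspective_inequality:
  fixes V :: "'i \<Rightarrow> 'j \<Rightarrow> complex"
  assumes f: "op_monotone f" "\<And>x. x > 0 \<Longrightarrow> f x \<ge> 0" "f 0 = 0" and fin: "finite I" "finite J"
    and \<mu>: "\<And>i. i \<in> I \<Longrightarrow> \<mu> i > 0" and \<kappa>: "\<And>i. i \<in> I \<Longrightarrow> \<kappa> i > 0"
    and c: "\<And>a. a \<in> J \<Longrightarrow> c a \<ge> 0" and d: "\<And>a. a \<in> J \<Longrightarrow> d a \<ge> 0"
    and le\<mu>: "\<And>u. (\<Sum>i\<in>I. \<mu> i * (cmod (\<Sum>a\<in>J. V i a * u a))\<^sup>2) \<le> (\<Sum>a\<in>J. c a * (cmod (u a))\<^sup>2)"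
    and le\<kappa>: "\<And>u. (\<Sum>i\<in>I. \<kappa> i * (cmod (\<Sum>a\<in>J. V i a * u a))\<^sup>2) \<le> (\<Sum>a\<in>J. d a * (cmod (u a))\<^sup>2)"
  shows "(\<Sum>i\<in>I. f (\<kappa> i / \<mu> i) * \<mu> i * (cmod (\<Sum>a\<in>J. V i a * u a))\<^sup>2) \<le> (\<Sum>a\<in>J. f (d a / c a) * c a * (cmod (u a))\<^sup>2)"
proof -
  \<comment> \<open>Where \<open>c a = 0\<close> or \<open>d a = 0\<close> the column of \<open>V\<close> vanishes, and so does the right-hand term,
    since \<open>x / 0 = 0\<close> and \<open>f 0 = 0\<close>.\<close>
  define good where "good a \<longleftrightarrow> c a > 0 \<and> d a > 0" for a
  \<comment> \<open>Test the hypotheses on the unit vector at \<open>a\<close>: one of the two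
    right-hand sides is then 0, while all weights on the left are positive.\<close>
  have zero: "V i a = 0" if "i \<in> I" "a \<in> J" and bad: "\<not> good a" for i a
  proof -
    define e where "e b = (if b = a then 1 else 0 :: complex)" for b
    have Ve: "(\<Sum>a\<in>J. V i a * e a) = V i a" for i
      using that fin by (simp add: e_def if_distrib[of "\<lambda>x. _ * x"] sum.delta cong: if_cong)
    have Je: "(\<Sum>a\<in>J. c a * (cmod (e a))\<^sup>2) = c a" for c
      using that fin by (simp add: e_def if_distrib[of "\<lambda>x. (cmod x)\<^sup>2"] if_distrib[of "\<lambda>x. _ * x"] sum.delta cong: if_cong)
    have *: "V i a = 0" if "g a \<le> 0" "\<And>i. i \<in> I \<Longrightarrow> \<nu> i > 0"
      "(\<Sum>i\<in>I. \<nu> i * (cmod (\<Sum>a\<in>J. V i a * e a))\<^sup>2) \<le> (\<Sum>a\<in>J. g a * (cmod (e a))\<^sup>2)" for \<nu> :: "'i \<Rightarrow> real" and g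
    proof -
      have "\<nu> i * (cmod (V i a))\<^sup>2 \<le> (\<Sum>i\<in>I. \<nu> i * (cmod (V i a))\<^sup>2)"
        using \<open>i \<in> I\<close> fin that(2) by (intro member_le_sum) (auto simp: less_imp_le)
      also have "\<dots> \<le> 0" using that(1,3) by (simp add: Ve Je)
      finally show ?thesis using that(2)[OF \<open>i \<in> I\<close>]
        by (simp add: mult_le_0_iff)
    qed
    have "c a \<le> 0 \<or> d a \<le> 0" using bad by (auto simp: good_def)
    then show ?thesis using *[of c \<mu>, OF _ \<mu> le\<mu>] *[of d \<kappa>, OF _ \<kappa> le\<kappa>] by blast
  qed
  define w where "w i a = (if good a then complex_of_real (sqrt (\<mu> i)) * V i a / complex_of_real (sqrt (c a)) else 0)" for i a
  \<comment> \<open>On a bad index the column of \<open>w\<close> is zero, so every positive value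
    of \<open>s\<close> is compatible with the bound.\<close>
  define s where "s a = (if good a then d a / c a else 1)" for a
  define t where "t i = \<kappa> i / \<mu> i" for i
  define r where "r u a = (if good a then u a / complex_of_real (sqrt (c a)) else 0)" for u a
  have wu: "(\<Sum>a\<in>J. w i a * u a) = complex_of_real (sqrt (\<mu> i)) * (\<Sum>a\<in>J. V i a * r u a)" for i u
    unfolding sum_distrib_left by (rule sum.cong) (auto simp: w_def r_def)
  have wn: "(cmod (\<Sum>a\<in>J. w i a * u a))\<^sup>2 = \<mu> i * (cmod (\<Sum>a\<in>J. V i a * r u a))\<^sup>2" if "i \<in> I" for i u
    unfolding wu using \<mu>[OF that] by (simp add: norm_mult power_mult_distrib)
  have "(\<Sum>i\<in>I. f (t i) * (cmod (\<Sum>a\<in>J. w i a * v a))\<^sup>2) \<le> (\<Sum>a\<in>J. f (s a) * (cmod (v a))\<^sup>2)" for v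
  proof (rule hansen_inequality[OF f(1,2) fin])
    fix u :: "'j \<Rightarrow> complex"
    have "(\<Sum>i\<in>I. (cmod (\<Sum>a\<in>J. w i a * u a))\<^sup>2) = (\<Sum>i\<in>I. \<mu> i * (cmod (\<Sum>a\<in>J. V i a * r u a))\<^sup>2)"
      by (simp add: wn)
    also have "\<dots> \<le> (\<Sum>a\<in>J. c a * (cmod (r u a))\<^sup>2)" by (rule le\<mu>)
    also have "\<dots> \<le> (\<Sum>a\<in>J. (cmod (u a))\<^sup>2)"
      by (rule sum_mono) (auto simp: r_def good_def norm_divide power_divide)
    finally show "(\<Sum>i\<in>I. (cmod (\<Sum>a\<in>J. w i a * u a))\<^sup>2) \<le> (\<Sum>a\<in>J. (cmod (u a))\<^sup>2)" .
    have "(\<Sum>i\<in>I. t i * (cmod (\<Sum>a\<in>J. w i a * u a))\<^sup>2) = (\<Sum>i\<in>I. \<kappa> i * (cmod (\<Sum>a\<in>J. V i a * r u a))\<^sup>2)"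
      by (intro sum.cong) (auto simp: wn t_def order_less_imp_not_eq2[OF \<mu>])
    also have "\<dots> \<le> (\<Sum>a\<in>J. d a * (cmod (r u a))\<^sup>2)" by (rule le\<kappa>)
    also have "\<dots> \<le> (\<Sum>a\<in>J. s a * (cmod (u a))\<^sup>2)"
      by (rule sum_mono) (auto simp: r_def s_def good_def norm_divide power_divide)
    finally show "(\<Sum>i\<in>I. t i * (cmod (\<Sum>a\<in>J. w i a * u a))\<^sup>2) \<le> (\<Sum>a\<in>J. s a * (cmod (u a))\<^sup>2)" .
  qed (auto simp: t_def s_def good_def \<mu> \<kappa>)
  \<comment> \<open>This argument is chosen so that \<open>r\<close> turns it back into
    \<open>u\<close> on the good indices; on the others the columns of \<open>V\<close>
    vanish.\<close>
  from this[of "\<lambda>a. if good a then complex_of_real (sqrt (c a)) * u a else 0"]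
  have main: "(\<Sum>i\<in>I. f (t i) * (cmod (\<Sum>a\<in>J. w i a * (if good a then complex_of_real (sqrt (c a)) * u a else 0)))\<^sup>2)
    \<le> (\<Sum>a\<in>J. f (s a) * (cmod (if good a then complex_of_real (sqrt (c a)) * u a else 0))\<^sup>2)" .
  have "(\<Sum>a\<in>J. V i a * r (\<lambda>a. if good a then complex_of_real (sqrt (c a)) * u a else 0) a) = (\<Sum>a\<in>J. V i a * u a)"
    if "i \<in> I" for i
    by (rule sum.cong) (use zero[OF that] in \<open>auto simp: r_def good_def\<close>)
  then have "(\<Sum>i\<in>I. f (\<kappa> i / \<mu> i) * \<mu> i * (cmod (\<Sum>a\<in>J. V i a * u a))\<^sup>2)
    = (\<Sum>i\<in>I. f (t i) * (cmod (\<Sum>a\<in>J. w i a * (if good a then complex_of_real (sqrt (c a)) * u a else 0)))\<^sup>2)"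
    by (intro sum.cong) (auto simp: wn t_def mult.assoc)
  also note main
  also have "(\<Sum>a\<in>J. f (s a) * (cmod (if good a then complex_of_real (sqrt (c a)) * u a else 0))\<^sup>2)
    = (\<Sum>a\<in>J. f (d a / c a) * c a * (cmod (u a))\<^sup>2)"
  proof (rule sum.cong[OF refl])
    fix a assume a: "a \<in> J"
    show "f (s a) * (cmod (if good a then complex_of_real (sqrt (c a)) * u a else 0))\<^sup>2 = f (d a / c a) * c a * (cmod (u a))\<^sup>2"
    proof (cases "good a")
      case True
      then show ?thesis by (simp add: s_def good_def norm_mult power_mult_distrib)
    next
      case False
      then have "c a = 0 \<or> d a = 0" using c[OF a] d[OF a] by (auto simp: good_def)
      then show ?thesis using False f(3) by auto
    qed
  qed
  finally show ?thesis .
qed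

section \<open>Schur multipliers with respect to a pair of unitaries\<close>

abbreviation sq :: "nat \<Rightarrow> (nat \<times> nat) set" where "sq k \<equiv> {..<k} \<times> {..<k}"

section \<open>Trace and Hilbert-Schmidt inner product\<close>

lemma eq_mat_sqI:
  assumes "A \<in> carrier_mat k k" "B \<in> carrier_mat k k" "\<And>p. p \<in> sq k \<Longrightarrow> A $$ p = B $$ p"
  shows "A = B"
  by (rule eq_matI) (use assms in auto)

lemma mtrace_comm:
  assumes "A \<in> carrier_mat n m" "B \<in> carrier_mat m n"
  shows "mtrace (A * B) = mtrace (B * A)"
proof -
  have "mtrace (A * B) = (\<Sum>i<n. \<Sum>j<m. A $$ (i,j) * B $$ (j,i))"
    using assms by (simp add: mtrace_def scalar_prod_def lessThan_atLeast0)
  also have "\<dots> = (\<Sum>j<m. \<Sum>i<n. A $$ (i,j) * B $$ (j,i))" by (rule sum.swap)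
  also have "\<dots> = mtrace (B * A)"
    using assms by (simp add: mtrace_def scalar_prod_def lessThan_atLeast0 mult.commute)
  finally show ?thesis .
qed

lemma mtrace_minus:
  assumes "A \<in> carrier_mat n n" "B \<in> carrier_mat n n"
  shows "mtrace (A - B) = mtrace A - mtrace B"
  using assms by (simp add: mtrace_def sum_subtractf)

lemma hs_inner_sum:
  assumes "A \<in> carrier_mat k k" "B \<in> carrier_mat k k"
  shows "hs_inner A B = (\<Sum>p\<in>sq k. cnj (A $$ p) * B $$ p)"
proof -
  have "hs_inner A B = (\<Sum>j<k. \<Sum>i<k. cnj (A $$ (i,j)) * B $$ (i,j))"
    using assms by (simp add: hs_inner_def mtrace_def scalar_prod_def lessThan_atLeast0)
  also have "\<dots> = (\<Sum>i<k. \<Sum>j<k. cnj (A $$ (i,j)) * B $$ (i,j))" by (rule sum.swap)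
  finally show ?thesis by (simp add: sum.cartesian_product split_def)
qed

lemma hs_inner_cnj:
  assumes "A \<in> carrier_mat k k" "B \<in> carrier_mat k k"
  shows "hs_inner B A = cnj (hs_inner A B)"
  using assms by (simp add: hs_inner_sum mult.commute)

lemma hs_inner_minus_right:
  assumes "A \<in> carrier_mat k k" "B \<in> carrier_mat k k" "C \<in> carrier_mat k k"
  shows "hs_inner A (B - C) = hs_inner A B - hs_inner A C"
proof -
  have "B - C \<in> carrier_mat k k" using assms by (intro minus_carrier_mat)
  then show ?thesis using assms
    by (auto simp add: hs_inner_sum[of _ k] sum_subtractf[symmetric] right_diff_distrib intro!: sum.cong)
qed

lemma hs_inner_lmul:
  assumes "C \<in> carrier_mat k k" "A \<in> carrier_mat k k" "B \<in> carrier_mat k k"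
  shows "hs_inner (C * A) B = hs_inner A (mat_adjoint C * B)"
  using assms unfolding hs_inner_def
  by (simp add: mat_adjoint_mult[of _ k k _ k] assoc_mult_mat[of _ k k _ k _ k])

lemma hs_inner_rmul:
  assumes "C \<in> carrier_mat k k" "A \<in> carrier_mat k k" "B \<in> carrier_mat k k"
  shows "hs_inner (A * C) B = hs_inner A (B * mat_adjoint C)"
proof -
  have "hs_inner (A * C) B = mtrace (mat_adjoint C * (mat_adjoint A * B))"
    using assms unfolding hs_inner_def
    by (simp add: mat_adjoint_mult[of _ k k _ k] assoc_mult_mat[of _ k k _ k _ k])
  also have "\<dots> = mtrace (mat_adjoint A * B * mat_adjoint C)"
    using assms by (intro mtrace_comm[of _ k k]) (auto intro!: mult_carrier_mat[of _ k k])
  also have "\<dots> = hs_inner A (B * mat_adjoint C)"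
    using assms unfolding hs_inner_def by (simp add: assoc_mult_mat[of _ k k _ k _ k])
  finally show ?thesis .
qed

lemma hs_inner_self_eq_0:
  assumes "A \<in> carrier_mat k k" "hs_inner A A = 0"
  shows "A = 0\<^sub>m k k"
proof (rule eq_mat_sqI[OF assms(1)])
  have "hs_inner A A = complex_of_real (\<Sum>p\<in>sq k. (cmod (A $$ p))\<^sup>2)"
    unfolding hs_inner_sum[OF assms(1,1)]
    by (simp add: complex_norm_square mult.commute del: of_real_power)
  then have z: "(\<Sum>p\<in>sq k. (cmod (A $$ p))\<^sup>2) = 0" using assms(2) of_real_eq_0_iff by metis
  fix p assume p: "p \<in> sq k"
  have "\<forall>p\<in>sq k. (cmod (A $$ p))\<^sup>2 = 0" using z by (subst (asm) sum_nonneg_eq_0_iff) auto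
  then show "A $$ p = 0\<^sub>m k k $$ p" using p by auto
qed simp

lemma hs_inner_eqI:
  assumes "A \<in> carrier_mat k k" "B \<in> carrier_mat k k"
    and "\<And>C. C \<in> carrier_mat k k \<Longrightarrow> hs_inner C A = hs_inner C B"
  shows "A = B"
proof -
  have c: "A - B \<in> carrier_mat k k" using assms by (intro minus_carrier_mat)
  have "hs_inner (A - B) (A - B) = 0"
    using assms(3)[OF c] hs_inner_minus_right[OF c assms(1,2)] by simp
  from hs_inner_self_eq_0[OF c this] have z: "A - B = 0\<^sub>m k k" .
  show ?thesis
  proof (rule eq_mat_sqI[OF assms(1,2)])
    fix p assume "p \<in> sq k"
    then show "A $$ p = B $$ p" using arg_cong[OF z, of "\<lambda>M. M $$ p"] assms by auto
  qed
qed

definition unit_mat :: "nat \<Rightarrow> nat \<times> nat \<Rightarrow> complex mat" where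
  "unit_mat k p = mat k k (\<lambda>q. if q = p then 1 else 0)"

lemma unit_mat_carrier [simp, intro]: "unit_mat k p \<in> carrier_mat k k"
  by (simp add: unit_mat_def)

lemma unit_mat_index:
  "q \<in> sq k \<Longrightarrow> unit_mat k p $$ q = (if q = p then 1 else 0)"
  by (auto simp: unit_mat_def)

text \<open>Induction over truncations of \<open>B\<close> to growing index sets: each new entry
  adds one multiple of a matrix unit, so additivity for two summands in the carrier
  suffices.\<close>

lemma linear_functional_expansion:
  fixes L :: "complex mat \<Rightarrow> complex"
  assumes add: "\<And>A B. A \<in> carrier_mat k k \<Longrightarrow> B \<in> carrier_mat k k \<Longrightarrow> L (A + B) = L A + L B"
    and smult: "\<And>c A. A \<in> carrier_mat k k \<Longrightarrow> L (c \<cdot>\<^sub>m A) = c * L A"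
    and B: "B \<in> carrier_mat k k"
  shows "L B = (\<Sum>p\<in>sq k. L (unit_mat k p) * B $$ p)"
proof -
  let ?B = "\<lambda>K. mat k k (\<lambda>q. if q \<in> K then B $$ q else 0)"
  have "L (?B K) = (\<Sum>p\<in>K. L (unit_mat k p) * B $$ p)" if "finite K" "K \<subseteq> sq k" for K
    using that
  proof (induction K rule: finite_induct)
    case empty
    have "?B {} = 0 \<cdot>\<^sub>m B" using B by (intro eq_matI) auto
    then show ?case using smult[OF B, of 0] by simp
  next
    case (insert p K)
    have "?B (insert p K) = B $$ p \<cdot>\<^sub>m unit_mat k p + ?B K"
      using insert.hyps by (intro eq_matI) (auto simp: unit_mat_def)
    then show ?case using insert by (simp add: add smult mult.commute)
  qed
  from this[of "sq k"] have "L (?B (sq k)) = (\<Sum>p\<in>sq k. L (unit_mat k p) * B $$ p)" by simp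
  moreover have "?B (sq k) = B" using B by (intro eq_matI) auto
  ultimately show ?thesis by simp
qed

section \<open>Coordinates adapted to two unitaries, and operators diagonal in them\<close>

locale unitary_pair =
  fixes k :: nat and P Q :: "complex mat"
  assumes P: "unitary_mat k P" and Q: "unitary_mat k Q"
begin

definition coord :: "complex mat \<Rightarrow> complex mat" where
  "coord A = mat_adjoint P * A * Q"

definition uncoord :: "complex mat \<Rightarrow> complex mat" where
  "uncoord B = P * B * mat_adjoint Q"

text \<open>A predicate rather than an equation with \<open>schur_op g\<close>: operators obtained
  by choice are determined on \<open>carrier_mat k k\<close> only.\<close>

definition diag_op :: "(nat \<times> nat \<Rightarrow> real) \<Rightarrow> (complex mat \<Rightarrow> complex mat) \<Rightarrow> bool" where
  "diag_op g T \<longleftrightarrow> (\<forall>A\<in>carrier_mat k k. T A \<in> carrier_mat k k \<and>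
     (\<forall>p\<in>sq k. coord (T A) $$ p = complex_of_real (g p) * coord A $$ p))"

definition schur_op :: "(nat \<times> nat \<Rightarrow> real) \<Rightarrow> complex mat \<Rightarrow> complex mat" where
  "schur_op g A = uncoord (mat k k (\<lambda>p. complex_of_real (g p) * coord A $$ p))"

lemmas Pc = unitary_matD[OF P]
lemmas Qc = unitary_matD[OF Q]
lemmas assoc_kk = assoc_mult_mat[of _ k k _ k _ k] mult_carrier_mat[of _ k k _ k]

lemma adj_carrier: "mat_adjoint P \<in> carrier_mat k k" "mat_adjoint Q \<in> carrier_mat k k"
  using Pc Qc by auto

lemma cancel_PQ:
  assumes "A \<in> carrier_mat k k"
  shows "mat_adjoint P * (P * A) = A" "P * (mat_adjoint P * A) = A"
    "mat_adjoint Q * (Q * A) = A" "Q * (mat_adjoint Q * A) = A"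
proof -
  have "mat_adjoint P * (P * A) = mat_adjoint P * P * A" "P * (mat_adjoint P * A) = P * mat_adjoint P * A"
    "mat_adjoint Q * (Q * A) = mat_adjoint Q * Q * A" "Q * (mat_adjoint Q * A) = Q * mat_adjoint Q * A"
    using assms Pc(1) Qc(1) adj_carrier by (simp_all add: assoc_kk)
  then show "mat_adjoint P * (P * A) = A" "P * (mat_adjoint P * A) = A"
    "mat_adjoint Q * (Q * A) = A" "Q * (mat_adjoint Q * A) = A" using assms Pc Qc by simp_all
qed

lemma coord_carrier [simp, intro]: "A \<in> carrier_mat k k \<Longrightarrow> coord A \<in> carrier_mat k k"
  unfolding coord_def using Pc Qc adj_carrier by (simp add: assoc_kk)

lemma coord_dim [simp]:
  "A \<in> carrier_mat k k \<Longrightarrow> dim_row (coord A) = k" "A \<in> carrier_mat k k \<Longrightarrow> dim_col (coord A) = k"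
  using carrier_matD[OF coord_carrier] by auto

lemma uncoord_carrier [simp, intro]: "A \<in> carrier_mat k k \<Longrightarrow> uncoord A \<in> carrier_mat k k"
  unfolding uncoord_def using Pc Qc adj_carrier by (simp add: assoc_kk)

lemma coord_uncoord [simp]: "A \<in> carrier_mat k k \<Longrightarrow> coord (uncoord A) = A"
  unfolding coord_def uncoord_def using Pc Qc adj_carrier by (simp add: assoc_kk cancel_PQ)

lemma uncoord_coord [simp]: "A \<in> carrier_mat k k \<Longrightarrow> uncoord (coord A) = A"
  unfolding coord_def uncoord_def using Pc Qc adj_carrier by (simp add: assoc_kk cancel_PQ)

lemma coord_eqI:
  assumes "A \<in> carrier_mat k k" "B \<in> carrier_mat k k" "\<And>p. p \<in> sq k \<Longrightarrow> coord A $$ p = coord B $$ p"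
  shows "A = B"
proof -
  have "coord A = coord B" by (rule eq_mat_sqI) (use assms in auto)
  then show ?thesis using assms by (metis uncoord_coord)
qed

lemma coord_add:
  "A \<in> carrier_mat k k \<Longrightarrow> B \<in> carrier_mat k k \<Longrightarrow> coord (A + B) = coord A + coord B"
  unfolding coord_def using Pc Qc adj_carrier
  by (simp add: mult_add_distrib_mat[of _ k k _ k] add_mult_distrib_mat[of _ k k _ _ k] assoc_kk)

lemma coord_smult: "A \<in> carrier_mat k k \<Longrightarrow> coord (c \<cdot>\<^sub>m A) = c \<cdot>\<^sub>m coord A"
  unfolding coord_def using Pc Qc adj_carrier
  by (simp add: mult_smult_distrib[of _ k k _ k] mult_smult_assoc_mat[of _ k k _ k] assoc_kk)

lemma uncoord_add:
  "A \<in> carrier_mat k k \<Longrightarrow> B \<in> carrier_mat k k \<Longrightarrow> uncoord (A + B) = uncoord A + uncoord B"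
  unfolding uncoord_def using Pc Qc adj_carrier
  by (simp add: mult_add_distrib_mat[of _ k k _ k] add_mult_distrib_mat[of _ k k _ _ k] assoc_kk)

lemma uncoord_smult: "A \<in> carrier_mat k k \<Longrightarrow> uncoord (c \<cdot>\<^sub>m A) = c \<cdot>\<^sub>m uncoord A"
  unfolding uncoord_def using Pc Qc adj_carrier
  by (simp add: mult_smult_distrib[of _ k k _ k] mult_smult_assoc_mat[of _ k k _ k] assoc_kk)

lemma hs_inner_coord:
  assumes "A \<in> carrier_mat k k" "B \<in> carrier_mat k k"
  shows "hs_inner A B = (\<Sum>p\<in>sq k. cnj (coord A $$ p) * coord B $$ p)"
proof -
  have c: "A * Q \<in> carrier_mat k k" "mat_adjoint P * (B * Q) \<in> carrier_mat k k"
    using assms Pc Qc adj_carrier by (simp_all add: assoc_kk)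
  have "hs_inner (coord A) (coord B) = hs_inner (mat_adjoint P * (A * Q)) (mat_adjoint P * (B * Q))"
    unfolding coord_def using assms Pc Qc adj_carrier by (simp add: assoc_kk)
  also have "\<dots> = hs_inner (A * Q) (B * Q)"
    using assms Qc hs_inner_lmul[OF adj_carrier(1) c] by (simp add: cancel_PQ assoc_kk)
  also have "\<dots> = hs_inner A B"
    using assms Qc hs_inner_rmul[OF Qc(1) assms(1), of "B * Q"] adj_carrier by (simp add: assoc_kk)
  finally have "hs_inner (coord A) (coord B) = hs_inner A B" .
  then show ?thesis using hs_inner_sum[of "coord A" k "coord B"] assms by simp
qed

lemma diag_op_carrier: "diag_op g T \<Longrightarrow> A \<in> carrier_mat k k \<Longrightarrow> T A \<in> carrier_mat k k"
  by (simp add: diag_op_def)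

lemma diag_op_coord:
  "diag_op g T \<Longrightarrow> A \<in> carrier_mat k k \<Longrightarrow> p \<in> sq k \<Longrightarrow> coord (T A) $$ p = complex_of_real (g p) * coord A $$ p"
  unfolding diag_op_def by blast

lemma diag_op_schur_op: "diag_op g (schur_op g)"
  unfolding diag_op_def schur_op_def by auto

lemma diag_op_cong:
  assumes "diag_op g T" "\<And>p. p \<in> sq k \<Longrightarrow> g p = h p" "\<And>A. A \<in> carrier_mat k k \<Longrightarrow> S A = T A"
  shows "diag_op h S"
  using assms by (auto simp: diag_op_def)

lemma diag_op_compose:
  assumes "diag_op g S" "diag_op h T"
  shows "diag_op (\<lambda>p. g p * h p) (S \<circ> T)"
  using assms by (auto simp: diag_op_def)

lemma diag_op_lin_map:
  assumes "diag_op g T"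
  shows "lin_map k k T"
  unfolding lin_map_def
proof (intro conjI ballI allI)
  note T = diag_op_carrier[OF assms] and Tc = diag_op_coord[OF assms]
  fix A :: "complex mat" assume A: "A \<in> carrier_mat k k"
  show "T A \<in> carrier_mat k k" by (rule T[OF A])
  show "T (c \<cdot>\<^sub>m A) = c \<cdot>\<^sub>m T A" for c
    by (rule coord_eqI) (use A in \<open>auto simp: T coord_smult Tc\<close>)
  fix B :: "complex mat" assume B: "B \<in> carrier_mat k k"
  show "T (A + B) = T A + T B"
    by (rule coord_eqI) (use A B in \<open>auto simp: T coord_add Tc algebra_simps\<close>)
qed

lemma diag_op_sa:
  assumes "diag_op g T"
  shows "op_sa k T"
  unfolding op_sa_def
  by (auto simp: hs_inner_coord diag_op_carrier[OF assms] diag_op_coord[OF assms] intro!: sum.cong)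

lemma diag_op_form:
  assumes "diag_op g T" "A \<in> carrier_mat k k"
  shows "hs_inner A (T A) = complex_of_real (\<Sum>p\<in>sq k. g p * (cmod (coord A $$ p))\<^sup>2)"
  using assms(2)
  by (auto simp: diag_op_carrier[OF assms(1)] diag_op_coord[OF assms(1)] hs_inner_coord complex_norm_square mult_ac simp del: of_real_power intro!: sum.cong)

section \<open>Generalised inverse, inverse and functional calculus of a diagonal operator\<close>

text \<open>With \<open>inverse 0 = 0\<close> the multiplier with symbol
  \<open>inverse (g p)\<close> satisfies all four Penrose conditions, also where \<open>g\<close>
  vanishes. Penrose's uniqueness argument then identifies it with the chosen operator.\<close>

lemma diag_op_mp:
  assumes T: "diag_op g T"
  shows "diag_op (\<lambda>p. inverse (g p)) (op_mp k T)"
proof -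
  let ?mp = "\<lambda>S. lin_map k k S \<and>
     (\<forall>A\<in>carrier_mat k k. T (S (T A)) = T A \<and> S (T (S A)) = S A) \<and>
     op_sa k (T \<circ> S) \<and> op_sa k (S \<circ> T)"
  define S0 where "S0 = schur_op (\<lambda>p. inverse (g p))"
  have S0: "diag_op (\<lambda>p. inverse (g p)) S0" unfolding S0_def by (rule diag_op_schur_op)
  note Tk = diag_op_carrier[OF T] and Sk = diag_op_carrier[OF S0]
  have mp0: "?mp S0"
  proof (intro conjI ballI)
    show "lin_map k k S0" by (rule diag_op_lin_map[OF S0])
    show "op_sa k (T \<circ> S0)" "op_sa k (S0 \<circ> T)"
      by (rule diag_op_sa[OF diag_op_compose[OF T S0]], rule diag_op_sa[OF diag_op_compose[OF S0 T]])
    fix A :: "complex mat" assume A: "A \<in> carrier_mat k k"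
    show "T (S0 (T A)) = T A" "S0 (T (S0 A)) = S0 A"
      by (rule coord_eqI; use A in \<open>auto simp: Tk Sk diag_op_coord[OF T] diag_op_coord[OF S0]\<close>)+
  qed
  have mp: "?mp (op_mp k T)" unfolding op_mp_def by (rule someI[of ?mp, OF mp0])
  define S where "S = op_mp k T"
  note mp = mp[folded S_def]
  have SkS: "S A \<in> carrier_mat k k" if "A \<in> carrier_mat k k" for A
    using mp that by (simp add: lin_map_def)
  have TS: "hs_inner (T (S A)) B = hs_inner A (T (S B))" "hs_inner (S (T A)) B = hs_inner A (S (T B))"
    "hs_inner (T (S0 A)) B = hs_inner A (T (S0 B))" "hs_inner (S0 (T A)) B = hs_inner A (S0 (T B))"
    if "A \<in> carrier_mat k k" "B \<in> carrier_mat k k" for A B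
    using mp mp0 that by (auto simp: op_sa_def)
  have ST: "T (S (T A)) = T A" "S (T (S A)) = S A" "T (S0 (T A)) = T A" "S0 (T (S0 A)) = S0 A"
    if "A \<in> carrier_mat k k" for A using mp mp0 that by auto
  \<comment> \<open>\<open>S\<close> after \<open>T\<close> and \<open>S0\<close> after
    \<open>T\<close> are self-adjoint idempotents with the kernel of \<open>T\<close>, hence the
    same orthogonal projection. Dually, in \<open>e2\<close> both products project onto the range of
    \<open>T\<close>.\<close>
  have e1: "S (T B) = S0 (T B)" if B: "B \<in> carrier_mat k k" for B
  proof (rule hs_inner_eqI)
    fix C :: "complex mat" assume C: "C \<in> carrier_mat k k"
    have "hs_inner C (S (T B)) = hs_inner (S (T C)) B" using TS(2)[OF C B] by simp
    also have "\<dots> = hs_inner (S (T (S0 (T C)))) B" using C by (simp add: ST)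
    also have "\<dots> = hs_inner (S0 (T C)) (S (T B))" using C B by (intro TS) (auto simp: Tk Sk)
    also have "\<dots> = hs_inner C (S0 (T (S (T B))))" using C B by (intro TS) (auto simp: Tk SkS)
    also have "\<dots> = hs_inner C (S0 (T B))" using B by (simp add: ST)
    finally show "hs_inner C (S (T B)) = hs_inner C (S0 (T B))" .
  qed (use B in \<open>auto simp: Tk Sk SkS\<close>)
  have e2: "T (S B) = T (S0 B)" if B: "B \<in> carrier_mat k k" for B
  proof (rule hs_inner_eqI)
    fix C :: "complex mat" assume C: "C \<in> carrier_mat k k"
    have "hs_inner C (T (S B)) = hs_inner C (T (S0 (T (S B))))" using B by (simp add: ST SkS)
    also have "\<dots> = hs_inner (T (S0 C)) (T (S B))" using C B by (intro TS[symmetric]) (auto simp: Tk SkS)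
    also have "\<dots> = hs_inner (T (S (T (S0 C)))) B" using C B by (intro TS[symmetric]) (auto simp: Tk Sk)
    also have "\<dots> = hs_inner (T (S0 C)) B" using C by (simp add: ST Sk)
    also have "\<dots> = hs_inner C (T (S0 B))" by (rule TS(3)[OF C B])
    finally show "hs_inner C (T (S B)) = hs_inner C (T (S0 B))" .
  qed (use B in \<open>auto simp: Tk Sk SkS\<close>)
  have "S A = S0 A" if A: "A \<in> carrier_mat k k" for A
  proof -
    have "S A = S (T (S A))" using A by (simp add: ST)
    also have "\<dots> = S0 (T (S A))" using A by (simp add: e1 SkS)
    also have "\<dots> = S0 (T (S0 A))" using A by (simp add: e2)
    finally show ?thesis using A by (simp add: ST)
  qed
  then show ?thesis unfolding S_def[symmetric] using S0 by (rule diag_op_cong[rotated 2]) auto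
qed

lemma diag_op_inv:
  assumes T: "diag_op g T" and g: "\<And>p. p \<in> sq k \<Longrightarrow> g p \<noteq> 0"
  shows "diag_op (\<lambda>p. inverse (g p)) (op_inv k T)"
proof -
  let ?inv = "\<lambda>S. lin_map k k S \<and> (\<forall>A\<in>carrier_mat k k. S (T A) = A \<and> T (S A) = A)"
  define S0 where "S0 = schur_op (\<lambda>p. inverse (g p))"
  have S0: "diag_op (\<lambda>p. inverse (g p)) S0" unfolding S0_def by (rule diag_op_schur_op)
  note Tk = diag_op_carrier[OF T] and Sk = diag_op_carrier[OF S0]
  have inv0: "?inv S0"
  proof (intro conjI ballI)
    show "lin_map k k S0" by (rule diag_op_lin_map[OF S0])
    fix A :: "complex mat" assume A: "A \<in> carrier_mat k k"
    show "S0 (T A) = A" "T (S0 A) = A"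
      by (rule coord_eqI; use A g in \<open>auto simp: Tk Sk diag_op_coord[OF T] diag_op_coord[OF S0]\<close>)+
  qed
  have inv: "?inv (op_inv k T)" unfolding op_inv_def by (rule someI[of ?inv, OF inv0])
  then have "op_inv k T A = S0 A" if "A \<in> carrier_mat k k" for A
    using that inv0 Sk by metis
  then show ?thesis using S0 by (rule diag_op_cong[rotated 2]) auto
qed

text \<open>A multiplier has the required effect on eigenvectors because a nonzero coordinate pins
  the eigenvalue to \<open>g p\<close>. Conversely, the matrices
  \<open>uncoord (unit_mat k p)\<close> are a basis of eigenvectors, so linearity leaves the choice
  no freedom on the carrier.\<close>

lemma diag_op_fun:
  assumes T: "diag_op g T"
  shows "diag_op (\<lambda>p. f (g p)) (op_fun k f T)"
proof -
  let ?F = "\<lambda>S. lin_map k k S \<and>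
     (\<forall>c A. A \<in> carrier_mat k k \<and> A \<noteq> 0\<^sub>m k k \<and> T A = c \<cdot>\<^sub>m A \<longrightarrow>
        S A = complex_of_real (f (Re c)) \<cdot>\<^sub>m A)"
  define S0 where "S0 = schur_op (\<lambda>p. f (g p))"
  have S0: "diag_op (\<lambda>p. f (g p)) S0" unfolding S0_def by (rule diag_op_schur_op)
  have "S0 A = complex_of_real (f (Re c)) \<cdot>\<^sub>m A" if A: "A \<in> carrier_mat k k" "T A = c \<cdot>\<^sub>m A" for c A
  proof (rule coord_eqI)
    fix p assume p: "p \<in> sq k"
    have "complex_of_real (g p) * coord A $$ p = c * coord A $$ p"
      using diag_op_coord[OF T A(1) p] A p by (auto simp: coord_smult)
    then have "coord A $$ p = 0 \<or> c = complex_of_real (g p)" by auto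
    then show "coord (S0 A) $$ p = coord (complex_of_real (f (Re c)) \<cdot>\<^sub>m A) $$ p"
      using diag_op_coord[OF S0 A(1) p] A p by (auto simp: coord_smult)
  qed (use A in \<open>auto simp: diag_op_carrier[OF S0]\<close>)
  then have "?F S0" using diag_op_lin_map[OF S0] by blast
  then have F: "?F (op_fun k f T)" unfolding op_fun_def by (rule someI[of ?F])
  define S where "S = op_fun k f T"
  note F = F[folded S_def]
  have lin: "S A \<in> carrier_mat k k" "S (A + B) = S A + S B" "S (c \<cdot>\<^sub>m A) = c \<cdot>\<^sub>m S A"
    if "A \<in> carrier_mat k k" "B \<in> carrier_mat k k" for A B c
    using F that by (auto simp: lin_map_def)
  have SE: "S (uncoord (unit_mat k p)) = complex_of_real (f (g p)) \<cdot>\<^sub>m uncoord (unit_mat k p)" if p: "p \<in> sq k" for p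
  proof -
    have "T (uncoord (unit_mat k p)) = complex_of_real (g p) \<cdot>\<^sub>m uncoord (unit_mat k p)"
      by (rule coord_eqI) (use p in \<open>auto simp: diag_op_carrier[OF T] diag_op_coord[OF T] coord_smult unit_mat_def\<close>)
    moreover have "uncoord (unit_mat k p) \<noteq> 0\<^sub>m k k"
    proof
      assume "uncoord (unit_mat k p) = 0\<^sub>m k k"
      then have "uncoord (unit_mat k p) = 0 \<cdot>\<^sub>m uncoord (unit_mat k p)" by auto
      then have "coord (uncoord (unit_mat k p)) = 0 \<cdot>\<^sub>m coord (uncoord (unit_mat k p))"
        by (metis coord_smult uncoord_carrier unit_mat_carrier)
      then have "unit_mat k p $$ p = (0 \<cdot>\<^sub>m unit_mat k p) $$ p" by simp
      then show False using p by (auto simp: unit_mat_def)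
    qed
    ultimately have "S (uncoord (unit_mat k p)) = complex_of_real (f (Re (complex_of_real (g p)))) \<cdot>\<^sub>m uncoord (unit_mat k p)"
      using F by blast
    then show ?thesis by simp
  qed
  have "diag_op (\<lambda>p. f (g p)) S"
    unfolding diag_op_def
  proof (intro ballI conjI)
    fix A :: "complex mat" assume A: "A \<in> carrier_mat k k"
    show "S A \<in> carrier_mat k k" by (rule lin[OF A A])
    fix p assume p: "p \<in> sq k"
    have "coord (S (uncoord (coord A))) $$ p = (\<Sum>q\<in>sq k. coord (S (uncoord (unit_mat k q))) $$ p * coord A $$ q)"
      by (rule linear_functional_expansion[of k "\<lambda>B. coord (S (uncoord B)) $$ p"])
        (use A p in \<open>auto simp: lin uncoord_add uncoord_smult coord_add coord_smult\<close>)
    also have "\<dots> = (\<Sum>q\<in>sq k. if q = p then complex_of_real (f (g p)) * coord A $$ p else 0)"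
    proof (rule sum.cong[OF refl])
      fix q assume q: "q \<in> sq k"
      have "coord (S (uncoord (unit_mat k q))) $$ p = complex_of_real (f (g q)) * unit_mat k q $$ p"
        unfolding SE[OF q] using p by (auto simp: coord_smult unit_mat_def)
      then show "coord (S (uncoord (unit_mat k q))) $$ p * coord A $$ q
          = (if q = p then complex_of_real (f (g p)) * coord A $$ p else 0)"
        using unit_mat_index[OF p, of q] by auto
    qed
    also have "\<dots> = complex_of_real (f (g p)) * coord A $$ p" using p by (subst sum.delta) auto
    finally show "coord (S A) $$ p = complex_of_real (f (g p)) * coord A $$ p" using A by simp
  qed
  then show ?thesis unfolding S_def .
qed

lemma diag_op_lmul:
  assumes "Y = P * rdiag k \<mu> * mat_adjoint P"
  shows "diag_op (\<lambda>p. \<mu> (fst p)) (lmul Y)"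
  unfolding diag_op_def lmul_def
proof (intro ballI conjI)
  have Yc: "Y \<in> carrier_mat k k" unfolding assms using Pc adj_carrier by (simp add: assoc_kk)
  fix A :: "complex mat" assume A: "A \<in> carrier_mat k k"
  show "Y * A \<in> carrier_mat k k" using Yc A by simp
  fix p assume p: "p \<in> sq k"
  have "coord (Y * A) = rdiag k \<mu> * coord A"
    unfolding coord_def assms using A Pc Qc adj_carrier by (simp add: assoc_kk cancel_PQ)
  then have "coord (Y * A) $$ p = (\<Sum>l = 0..<k. (if l = fst p then complex_of_real (\<mu> (fst p)) * coord A $$ p else 0))"
    using p coord_carrier[OF A]
    by (auto simp: rdiag_def scalar_prod_def if_distrib[of "\<lambda>x. x * _"] if_distrib[of "\<lambda>x. _ * x"] cong: if_cong)
  then show "coord (Y * A) $$ p = complex_of_real (\<mu> (fst p)) * coord A $$ p" using p by auto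
qed

lemma diag_op_rmul:
  assumes "X = Q * rdiag k \<kappa> * mat_adjoint Q"
  shows "diag_op (\<lambda>p. \<kappa> (snd p)) (rmul X)"
  unfolding diag_op_def rmul_def
proof (intro ballI conjI)
  have Xc: "X \<in> carrier_mat k k" unfolding assms using Qc adj_carrier by (simp add: assoc_kk)
  fix A :: "complex mat" assume A: "A \<in> carrier_mat k k"
  show "A * X \<in> carrier_mat k k" using Xc A by simp
  fix p assume p: "p \<in> sq k"
  have "coord (A * X) = coord A * rdiag k \<kappa>"
    unfolding coord_def assms using A Pc Qc adj_carrier
    by (simp add: assoc_kk cancel_PQ right_mult_one_mat[of "rdiag k \<kappa>" k k])
  then have "coord (A * X) $$ p = (\<Sum>l = 0..<k. (if l = snd p then complex_of_real (\<kappa> (snd p)) * coord A $$ p else 0))"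
    using p coord_carrier[OF A]
    by (auto simp: rdiag_def scalar_prod_def if_distrib[of "\<lambda>x. x * _"] if_distrib[of "\<lambda>x. _ * x"] cong: if_cong)
  then show "coord (A * X) $$ p = complex_of_real (\<kappa> (snd p)) * coord A $$ p" using p by auto
qed

text \<open>The convention \<open>x / 0 = 0\<close> agrees with the Moore-Penrose inverse, so the
  same symbol is correct for singular \<open>Y\<close>.\<close>

lemma diag_op_Jf:
  assumes "Y = P * rdiag k \<mu> * mat_adjoint P" "X = Q * rdiag k \<kappa> * mat_adjoint Q"
  shows "diag_op (\<lambda>p. f (\<kappa> (snd p) / \<mu> (fst p)) * \<mu> (fst p)) (Jf k f X Y)"
  unfolding Jf_def divide_inverse
  by (intro diag_op_compose diag_op_fun diag_op_mp diag_op_lmul diag_op_rmul assms)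

end

section \<open>Schwarz maps\<close>

lemma pd_mat_spectral:
  assumes "pd_mat k A"
  obtains U d where "unitary_mat k U" "A = U * rdiag k d * mat_adjoint U" "\<And>i. i < k \<Longrightarrow> d i > 0"
proof -
  obtain U d where U: "unitary_mat k U" and A: "A = U * rdiag k d * mat_adjoint U"
    and d: "\<And>i. i < k \<Longrightarrow> d i \<ge> 0"
    using psd_mat_spectral[OF pd_mat_imp_psd[OF assms]] by metis
  note Uc = unitary_matD[OF U]
  have "d i > 0" if i: "i < k" for i
  proof (rule ccontr)
    assume "\<not> d i > 0"
    then have d0: "d i = 0" using d[OF i] by simp
    define v where "v = U *\<^sub>v unit_vec k i"
    have v: "v \<in> carrier_vec k" using Uc by (simp add: v_def)
    have U'v: "mat_adjoint U *\<^sub>v v = unit_vec k i"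
      unfolding v_def using Uc by (simp add: assoc_mult_mat_vec[of _ k k _ k, symmetric])
    have "v \<noteq> 0\<^sub>v k"
    proof
      assume "v = 0\<^sub>v k"
      then have "unit_vec k i = (0\<^sub>v k :: complex vec)"
        unfolding U'v[symmetric] using Uc by (intro eq_vecI) (auto simp: scalar_prod_def)
      then show False using i by simp
    qed
    then have pos: "(A *\<^sub>v v) \<bullet>c v > 0" using assms v by (simp add: pd_mat_def)
    have "A *\<^sub>v v = U *\<^sub>v (rdiag k d *\<^sub>v (mat_adjoint U *\<^sub>v v))"
      unfolding A using Uc v by (intro triple_mult_mat_vec[of _ k k _ k _ k]) auto
    also have "\<dots> = U *\<^sub>v (0 \<cdot>\<^sub>v unit_vec k i)"
      unfolding U'v using i by (simp add: mult_mat_vec_unit rdiag_col d0)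
    also have "\<dots> = 0 \<cdot>\<^sub>v v" unfolding v_def using Uc by (intro mult_mat_vec[of U k k]) auto
    finally have "(A *\<^sub>v v) \<bullet>c v = 0" using v by (simp add: scalar_prod_def)
    then show False using pos by simp
  qed
  then show thesis using that U A by blast
qed

lemma psd_mat_add:
  assumes "psd_mat k A" "psd_mat k B"
  shows "psd_mat k (A + B)"
  using assms unfolding psd_mat_def
  by (auto simp: add_mult_distrib_mat_vec[of _ k k] add_scalar_prod_distrib[of _ k])

lemma psd_mat_adjoint_mult:
  assumes "A \<in> carrier_mat k k"
  shows "psd_mat k (mat_adjoint A * A)"
proof -
  have "psd_mat k (1\<^sub>m k)"
    unfolding psd_mat_def using conjugate_square_ge_0_vec by auto
  from psd_mat_congruence[OF this assms] show ?thesis using assms by simp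
qed

lemma psd_mat_diag_nonneg:
  assumes "psd_mat k A" "i < k"
  shows "A $$ (i,i) \<ge> 0"
proof -
  have A: "A \<in> carrier_mat k k" using assms by (simp add: psd_mat_def)
  have "(A *\<^sub>v unit_vec k i) \<bullet>c unit_vec k i \<ge> 0" using assms by (simp add: psd_mat_def)
  also have "(A *\<^sub>v unit_vec k i) \<bullet>c unit_vec k i = (\<Sum>j = 0..<k. if j = i then A $$ (j,i) else 0)"
    using A assms(2) unfolding scalar_prod_def by (intro sum.cong) (auto simp: mult_mat_vec_unit)
  also have "\<dots> = A $$ (i,i)" using assms(2) by simp
  finally show ?thesis .
qed

text \<open>The product itself need not be positive, but in an eigenbasis of \<open>B\<close> its
  trace is the sum of the diagonal entries of \<open>A\<close> weighted by the eigenvalues of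
  \<open>B\<close>.\<close>

lemma mtrace_psd_mult_nonneg:
  assumes "psd_mat k A" "psd_mat k B"
  shows "mtrace (A * B) \<ge> 0"
proof -
  obtain U d where U: "unitary_mat k U" and B: "B = U * rdiag k d * mat_adjoint U"
    and d: "\<And>i. i < k \<Longrightarrow> d i \<ge> 0" using psd_mat_spectral[OF assms(2)] by metis
  note Uc = unitary_matD[OF U]
  have A: "A \<in> carrier_mat k k" using assms by (simp add: psd_mat_def)
  define C where "C = mat_adjoint U * A * U"
  have C: "psd_mat k C" unfolding C_def by (rule psd_mat_congruence[OF assms(1) Uc(1)])
  then have Cc: "C \<in> carrier_mat k k" by (simp add: psd_mat_def)
  have U'c: "mat_adjoint U \<in> carrier_mat k k" using Uc by auto
  note assoc = assoc_mult_mat[of _ k k _ k _ k] mult_carrier_mat[of _ k k _ k]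
  have "mtrace (A * B) = mtrace ((A * U * rdiag k d) * mat_adjoint U)"
    unfolding B using A Uc(1) U'c by (simp add: assoc)
  also have "\<dots> = mtrace (mat_adjoint U * (A * U * rdiag k d))"
    using A Uc(1) U'c by (intro mtrace_comm[of _ k k]) (auto simp: assoc)
  also have "mat_adjoint U * (A * U * rdiag k d) = C * rdiag k d"
    unfolding C_def using A Uc(1) U'c by (simp add: assoc)
  also have "mtrace (C * rdiag k d) = (\<Sum>i<k. C $$ (i,i) * complex_of_real (d i))"
  proof -
    have "(C * rdiag k d) $$ (i,i) = C $$ (i,i) * complex_of_real (d i)" if "i < k" for i
      using that Cc by (auto simp: rdiag_def scalar_prod_def if_distrib[of "\<lambda>x. _ * x"] cong: if_cong)
    then show ?thesis using Cc by (simp add: mtrace_def)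
  qed
  also have "\<dots> \<ge> 0"
  proof (rule sum_nonneg)
    fix i assume "i \<in> {..<k}"
    then show "0 \<le> C $$ (i,i) * complex_of_real (d i)"
      using psd_mat_diag_nonneg[OF C, of i] d[of i] by (simp add: less_eq_complex_def)
  qed
  finally show ?thesis .
qed

section \<open>Consequences of the Schwarz inequality\<close>

locale schwarz_map =
  fixes n m :: nat and \<phi> \<phi>adj :: "complex mat \<Rightarrow> complex mat"
  assumes lin: "lin_map n m \<phi>"
    and schwarz: "\<forall>K\<in>carrier_mat n n. mat_le m (mat_adjoint (\<phi> K) * \<phi> K) (\<phi> (mat_adjoint K * K))"
    and adj: "hs_adjoint n m \<phi> \<phi>adj"
begin

lemma map_carrier [simp]: "A \<in> carrier_mat n n \<Longrightarrow> \<phi> A \<in> carrier_mat m m"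
  using lin by (simp add: lin_map_def)

lemma map_add: "A \<in> carrier_mat n n \<Longrightarrow> B \<in> carrier_mat n n \<Longrightarrow> \<phi> (A + B) = \<phi> A + \<phi> B"
  using lin by (simp add: lin_map_def)

lemma map_smult: "A \<in> carrier_mat n n \<Longrightarrow> \<phi> (c \<cdot>\<^sub>m A) = c \<cdot>\<^sub>m \<phi> A"
  using lin by (simp add: lin_map_def)

lemma adj_carrier [simp]: "B \<in> carrier_mat m m \<Longrightarrow> \<phi>adj B \<in> carrier_mat n n"
  using adj by (simp add: hs_adjoint_def)

lemma adj_inner:
  "A \<in> carrier_mat n n \<Longrightarrow> B \<in> carrier_mat m m \<Longrightarrow> hs_inner (\<phi> A) B = hs_inner A (\<phi>adj B)"
  using adj by (simp add: hs_adjoint_def)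

lemma schwarz_psd:
  "K \<in> carrier_mat n n \<Longrightarrow> psd_mat m (\<phi> (mat_adjoint K * K) - mat_adjoint (\<phi> K) * \<phi> K)"
  using schwarz by (simp add: mat_le_def)

lemma map_psd:
  assumes K: "K \<in> carrier_mat n n"
  shows "psd_mat m (\<phi> (mat_adjoint K * K))"
proof -
  have KK: "\<phi> (mat_adjoint K * K) \<in> carrier_mat m m" using K by (intro map_carrier) auto
  have \<phi>K: "\<phi> K \<in> carrier_mat m m" using K by simp
  have "psd_mat m ((\<phi> (mat_adjoint K * K) - mat_adjoint (\<phi> K) * \<phi> K) + mat_adjoint (\<phi> K) * \<phi> K)"
    by (rule psd_mat_add[OF schwarz_psd[OF K] psd_mat_adjoint_mult[OF \<phi>K]])
  also have "(\<phi> (mat_adjoint K * K) - mat_adjoint (\<phi> K) * \<phi> K) + mat_adjoint (\<phi> K) * \<phi> K = \<phi> (mat_adjoint K * K)"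
    using KK \<phi>K by (intro eq_matI) auto
  finally show ?thesis .
qed

lemma map_adjoint:
  assumes K: "K \<in> carrier_mat n n"
  shows "\<phi> (mat_adjoint K) = mat_adjoint (\<phi> K)"
proof -
  have herm: "mat_adjoint (\<phi> (L + mat_adjoint L)) = \<phi> (L + mat_adjoint L)" if L: "L \<in> carrier_mat n n" for L
  proof -
    have L': "mat_adjoint L \<in> carrier_mat n n" and LL: "mat_adjoint L * L \<in> carrier_mat n n" using L by auto
    have one: "mat_adjoint (1\<^sub>m n) * (1\<^sub>m n) = (1\<^sub>m n :: complex mat)" by simp
    have "mat_adjoint (L + 1\<^sub>m n) * (L + 1\<^sub>m n) = mat_adjoint L * L + (L + mat_adjoint L) + 1\<^sub>m n" (is "?l = ?r")
    proof -
      have "?l = (mat_adjoint L + 1\<^sub>m n) * (L + 1\<^sub>m n)" using L by (simp add: mat_adjoint_add[of _ n n])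
      also have "\<dots> = mat_adjoint L * (L + 1\<^sub>m n) + 1\<^sub>m n * (L + 1\<^sub>m n)"
        using L L' by (intro add_mult_distrib_mat[of _ n n _ _ n]) auto
      also have "\<dots> = mat_adjoint L * L + mat_adjoint L + (L + 1\<^sub>m n)"
        using L L' by (simp add: mult_add_distrib_mat[of _ n n _ n])
      also have "\<dots> = ?r" using L L' LL by (intro eq_matI) auto
      finally show ?thesis .
    qed
    moreover have "psd_mat m (\<phi> (mat_adjoint (L + 1\<^sub>m n) * (L + 1\<^sub>m n)))" using L by (intro map_psd) auto
    ultimately have h: "mat_adjoint (\<phi> ?r) = \<phi> ?r" by (simp add: psd_mat_hermitian)
    have e: "\<phi> ?r = \<phi> (mat_adjoint L * L) + \<phi> (L + mat_adjoint L) + \<phi> (1\<^sub>m n)"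
      using L L' LL map_add[of "mat_adjoint L * L + (L + mat_adjoint L)" "1\<^sub>m n"]
        map_add[of "mat_adjoint L * L" "L + mat_adjoint L"] by simp
    have h1: "mat_adjoint (\<phi> (mat_adjoint L * L)) = \<phi> (mat_adjoint L * L)"
      by (rule psd_mat_hermitian[OF map_psd[OF L]])
    have h2: "mat_adjoint (\<phi> (1\<^sub>m n)) = \<phi> (1\<^sub>m n)"
      using psd_mat_hermitian[OF map_psd[of "1\<^sub>m n"]] by simp
    define a where "a = \<phi> (mat_adjoint L * L)"
    define b where "b = \<phi> (L + mat_adjoint L)"
    define c where "c = \<phi> (1\<^sub>m n)"
    have c: "a \<in> carrier_mat m m" "b \<in> carrier_mat m m" "c \<in> carrier_mat m m"
      using L L' LL by (simp_all add: a_def b_def c_def)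
    have abc: "a + mat_adjoint b + c = a + b + c"
      using h[unfolded e, folded a_def b_def c_def] h1[folded a_def] h2[folded c_def] c
      by (simp add: mat_adjoint_add[of _ m m])
    have "mat_adjoint b $$ (i,j) = b $$ (i,j)" if "i < m" "j < m" for i j
    proof -
      have "(a + mat_adjoint b + c) $$ (i,j) = (a + b + c) $$ (i,j)" unfolding abc ..
      then show ?thesis using that c by simp
    qed
    then have "mat_adjoint b = b" using c by (intro eq_matI) (auto simp del: mat_adjoint_index)
    then show ?thesis by (simp add: b_def)
  qed
  have K': "mat_adjoint K \<in> carrier_mat n n" using K by auto
  define a where "a = \<phi> (mat_adjoint K)"
  define b where "b = \<phi> K"
  have c: "a \<in> carrier_mat m m" "b \<in> carrier_mat m m" using K K' by (simp_all add: a_def b_def)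
  have 1: "mat_adjoint (b + a) = b + a"
    using herm[OF K] K K' by (simp add: map_add a_def b_def)
  have 2: "mat_adjoint (\<i> \<cdot>\<^sub>m b + (- \<i>) \<cdot>\<^sub>m a) = \<i> \<cdot>\<^sub>m b + (- \<i>) \<cdot>\<^sub>m a"
    using herm[of "\<i> \<cdot>\<^sub>m K"] K K' by (simp add: map_add map_smult mat_adjoint_smult a_def b_def)
  show ?thesis
    unfolding a_def[symmetric] b_def[symmetric]
  proof (rule eq_matI)
    fix i j assume "i < dim_row (mat_adjoint b)" "j < dim_col (mat_adjoint b)"
    then have ij: "i < m" "j < m" using c by auto
    have "cnj (b $$ (j,i)) + cnj (a $$ (j,i)) = b $$ (i,j) + a $$ (i,j)"
      using arg_cong[OF 1, of "\<lambda>M. M $$ (i,j)"] ij c by simp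
    moreover have "- \<i> * cnj (b $$ (j,i)) + \<i> * cnj (a $$ (j,i)) = \<i> * b $$ (i,j) - \<i> * a $$ (i,j)"
      using arg_cong[OF 2, of "\<lambda>M. M $$ (i,j)"] ij c by simp
    then have "- cnj (b $$ (j,i)) + cnj (a $$ (j,i)) = b $$ (i,j) - a $$ (i,j)"
      by (simp add: complex_eq_iff)
    ultimately have "cnj (b $$ (j,i)) = a $$ (i,j)" by (simp add: complex_eq_iff)
    then show "a $$ (i,j) = mat_adjoint b $$ (i,j)" using ij c by simp
  qed (use c in auto)
qed

lemma schwarz_mtrace:
  assumes K: "K \<in> carrier_mat n n" and X: "psd_mat m X"
  shows "mtrace (mat_adjoint (\<phi> K) * \<phi> K * X) \<le> mtrace (mat_adjoint K * K * \<phi>adj X)"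
proof -
  have Xc: "X \<in> carrier_mat m m" using X by (simp add: psd_mat_def)
  define a where "a = \<phi> (mat_adjoint K * K)"
  define b where "b = mat_adjoint (\<phi> K) * \<phi> K"
  have KK: "mat_adjoint K * K \<in> carrier_mat n n" using K by auto
  have a: "a \<in> carrier_mat m m" and b: "b \<in> carrier_mat m m" using KK map_carrier[OF K] by (auto simp: a_def b_def)
  have "0 \<le> mtrace ((a - b) * X)"
    using mtrace_psd_mult_nonneg[OF schwarz_psd[OF K] X] by (simp add: a_def b_def)
  also have "(a - b) * X = a * X - b * X" using a b Xc by (intro minus_mult_distrib_mat[of _ m m]) auto
  also have "mtrace (a * X - b * X) = mtrace (a * X) - mtrace (b * X)"
    using a b Xc by (intro mtrace_minus[of _ m]) auto
  also have "mtrace (a * X) = hs_inner a X"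
    using psd_mat_hermitian[OF map_psd[OF K]] by (simp add: hs_inner_def a_def)
  also have "\<dots> = hs_inner (mat_adjoint K * K) (\<phi>adj X)" unfolding a_def using KK Xc by (rule adj_inner)
  also have "\<dots> = mtrace (mat_adjoint K * K * \<phi>adj X)"
    using K by (simp add: hs_inner_def mat_adjoint_mult[of _ n n _ n])
  finally show ?thesis by (simp add: b_def)
qed

lemma schwarz_rmul:
  assumes K: "K \<in> carrier_mat n n" and X: "psd_mat m X"
  shows "hs_inner (\<phi> K) (\<phi> K * X) \<le> hs_inner K (K * \<phi>adj X)"
proof -
  have Xc: "X \<in> carrier_mat m m" using X by (simp add: psd_mat_def)
  show ?thesis using schwarz_mtrace[OF assms] K Xc map_carrier[OF K]
    by (simp add: hs_inner_def assoc_mult_mat[of _ n n _ n _ n] assoc_mult_mat[of _ m m _ m _ m])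
qed

text \<open>Cyclicity of the trace turns left multiplication into a pairing with
  \<open>K K\<^sup>*\<close>. So the trace inequality is applied to the adjoint of \<open>K\<close>,
  and \<open>map_adjoint\<close> brings the result back to \<open>\<phi> K\<close>.\<close>

lemma schwarz_lmul:
  assumes K: "K \<in> carrier_mat n n" and X: "psd_mat m X"
  shows "hs_inner (\<phi> K) (X * \<phi> K) \<le> hs_inner K (\<phi>adj X * K)"
proof -
  have Xc: "X \<in> carrier_mat m m" using X by (simp add: psd_mat_def)
  have K': "mat_adjoint K \<in> carrier_mat n n" using K by auto
  have sw: "hs_inner A (B * A) = mtrace (A * mat_adjoint A * B)"
    if "A \<in> carrier_mat k k" "B \<in> carrier_mat k k" for A B k
  proof -
    have "hs_inner A (B * A) = mtrace ((mat_adjoint A * B) * A)"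
      unfolding hs_inner_def using that by (simp add: assoc_mult_mat[of _ k k _ k _ k])
    also have "\<dots> = mtrace (A * (mat_adjoint A * B))"
      using that by (intro mtrace_comm[of _ k k]) (auto intro!: mult_carrier_mat[of _ k k])
    finally show ?thesis using that by (simp add: assoc_mult_mat[of _ k k _ k _ k])
  qed
  show ?thesis using schwarz_mtrace[OF K' X] sw[OF K, of "\<phi>adj X"] sw[OF map_carrier[OF K] Xc] Xc
    by (simp add: map_adjoint[OF K])
qed

text \<open>The form of \<open>\<phi>adj X\<close> at \<open>v\<close> is the trace of
  \<open>\<phi>adj X\<close> against \<open>v v\<^sup>*\<close>, which the trace inequality bounds
  below by a trace of two positive factors. The witness stores \<open>v\<^sup>*\<close> in row 0,
  hence the separate case \<open>n = 0\<close>.\<close>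

lemma adj_psd:
  assumes X: "psd_mat m X"
  shows "psd_mat n (\<phi>adj X)"
  unfolding psd_mat_def
proof (intro conjI ballI)
  have Xc: "X \<in> carrier_mat m m" using X by (simp add: psd_mat_def)
  then show Ac: "\<phi>adj X \<in> carrier_mat n n" by simp
  fix v :: "complex vec" assume v: "v \<in> carrier_vec n"
  define A where "A = \<phi>adj X"
  note Ac = Ac[folded A_def]
  show "0 \<le> (\<phi>adj X *\<^sub>v v) \<bullet>c v"
  proof (cases "n = 0")
    case True
    then show ?thesis using v by (simp add: scalar_prod_def)
  next
    case False
    \<comment> \<open>\<open>K\<^sup>* K = v v\<^sup>*\<close>\<close>
    define K where "K = mat n n (\<lambda>(i,j). if i = 0 then cnj (v $ j) else 0)"
    have K: "K \<in> carrier_mat n n" by (simp add: K_def)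
    have "0 \<le> mtrace (mat_adjoint (\<phi> K) * \<phi> K * X)"
      using mtrace_psd_mult_nonneg[OF psd_mat_adjoint_mult[OF map_carrier[OF K]] X] .
    also have "\<dots> \<le> mtrace (mat_adjoint K * K * A)" unfolding A_def by (rule schwarz_mtrace[OF K X])
    also have "\<dots> = hs_inner K (K * A)"
      using K Ac by (simp add: hs_inner_def assoc_mult_mat[of _ n n _ n _ n])
    also have "\<dots> = (\<Sum>i<n. \<Sum>j<n. cnj (K $$ (i,j)) * (K * A) $$ (i,j))"
      using hs_inner_sum[OF K, of "K * A"] K Ac by (simp add: sum.cartesian_product split_def del: index_mult_mat)
    also have "\<dots> = (\<Sum>i<n. if i = 0 then (\<Sum>j<n. v $ j * (K * A) $$ (0,j)) else 0)"
      by (rule sum.cong) (auto simp: K_def)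
    also have "\<dots> = (\<Sum>j<n. v $ j * (K * A) $$ (0,j))" using False by simp
    also have "\<dots> = (\<Sum>j<n. \<Sum>l<n. A $$ (l,j) * v $ j * cnj (v $ l))"
      using False Ac by (auto simp: K_def scalar_prod_def lessThan_atLeast0 sum_distrib_left intro!: sum.cong)
    also have "\<dots> = (\<Sum>l<n. \<Sum>j<n. A $$ (l,j) * v $ j * cnj (v $ l))" by (rule sum.swap)
    also have "\<dots> = (A *\<^sub>v v) \<bullet>c v"
      using v Ac by (simp add: scalar_prod_def sum_distrib_right lessThan_atLeast0)
    finally show ?thesis by (simp add: A_def)
  qed
qed

end

section \<open>The two operator inequalities, read off in coordinates\<close>

theorem theorem4p4:
  fixes f :: "real \<Rightarrow> real" and n m :: nat
    and \<phi> \<phi>adj :: "complex mat \<Rightarrow> complex mat" and X Y :: "complex mat"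
  assumes f_pos: "\<forall>x>0. f x > 0"
    and f_zero: "f 0 = 0"
    and f_opmon: "op_monotone f"
    and phi_lin: "lin_map n m \<phi>"
    and schwarz: "\<forall>K\<in>carrier_mat n n. mat_le m (mat_adjoint (\<phi> K) * \<phi> K) (\<phi> (mat_adjoint K * K))"
    and adj: "hs_adjoint n m \<phi> \<phi>adj"
    and X: "pd_mat m X" and Y: "pd_mat m Y"
  shows "op_le m (\<phi> \<circ> op_mp n (Jf n f (\<phi>adj X) (\<phi>adj Y)) \<circ> \<phi>adj) (op_inv m (Jf m f X Y)) \<and>
         op_le n (\<phi>adj \<circ> Jf m f X Y \<circ> \<phi>) (Jf n f (\<phi>adj X) (\<phi>adj Y))"
proof -
  interpret schwarz_map n m \<phi> \<phi>adj
    by unfold_locales (use phi_lin schwarz adj in auto)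
  note psdX = pd_mat_imp_psd[OF X] and psdY = pd_mat_imp_psd[OF Y]
  obtain U \<mu> where U: "unitary_mat m U" and YU: "Y = U * rdiag m \<mu> * mat_adjoint U"
    and \<mu>: "\<And>i. i < m \<Longrightarrow> \<mu> i > 0" using pd_mat_spectral[OF Y] by metis
  obtain W \<kappa> where W: "unitary_mat m W" and XW: "X = W * rdiag m \<kappa> * mat_adjoint W"
    and \<kappa>: "\<And>i. i < m \<Longrightarrow> \<kappa> i > 0" using pd_mat_spectral[OF X] by metis
  obtain P c where P: "unitary_mat n P" and YP: "\<phi>adj Y = P * rdiag n c * mat_adjoint P"
    and c: "\<And>i. i < n \<Longrightarrow> c i \<ge> 0" using psd_mat_spectral[OF adj_psd[OF psdY]] by metis
  obtain Q d where Q: "unitary_mat n Q" and XQ: "\<phi>adj X = Q * rdiag n d * mat_adjoint Q"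
    and d: "\<And>i. i < n \<Longrightarrow> d i \<ge> 0" using psd_mat_spectral[OF adj_psd[OF psdX]] by metis
  interpret M: unitary_pair m U W by unfold_locales (rule U, rule W)
  interpret N: unitary_pair n P Q by unfold_locales (rule P, rule Q)
  define J where "J = Jf m f X Y"
  define J' where "J' = Jf n f (\<phi>adj X) (\<phi>adj Y)"
  define \<alpha> where "\<alpha> p = f (\<kappa> (snd p) / \<mu> (fst p)) * \<mu> (fst p)" for p
  define \<gamma> where "\<gamma> p = f (d (snd p) / c (fst p)) * c (fst p)" for p
  have J: "M.diag_op \<alpha> J" unfolding J_def \<alpha>_def by (rule M.diag_op_Jf[OF YU XW])
  have J': "N.diag_op \<gamma> J'" unfolding J'_def \<gamma>_def by (rule N.diag_op_Jf[OF YP XQ])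
  \<comment> \<open>All multipliers of \<open>J\<close> are positive since \<open>X\<close> and
    \<open>Y\<close> are definite, so \<open>J\<close> is invertible; the multipliers
    \<open>\<gamma>\<close> of \<open>J'\<close> may vanish.\<close>
  have \<alpha>: "\<alpha> p > 0" if "p \<in> sq m" for p
    unfolding \<alpha>_def using that f_pos \<mu> \<kappa> by (auto intro!: mult_pos_pos)
  \<comment> \<open>\<open>V\<close> is the matrix of \<open>\<phi>\<close> between the coordinates
    given by \<open>P\<close>, \<open>Q\<close> and those given by \<open>U\<close>,
    \<open>W\<close>.\<close>
  define V where "V p a = M.coord (\<phi> (N.uncoord (unit_mat n a))) $$ p" for p a
  have V: "M.coord (\<phi> A) $$ p = (\<Sum>a\<in>sq n. V p a * N.coord A $$ a)"
    if A: "A \<in> carrier_mat n n" and p: "p \<in> sq m" for A p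
  proof -
    have "M.coord (\<phi> (N.uncoord (N.coord A))) $$ p = (\<Sum>a\<in>sq n. V p a * N.coord A $$ a)"
      unfolding V_def
      by (rule linear_functional_expansion[of n "\<lambda>B. M.coord (\<phi> (N.uncoord B)) $$ p"])
        (use A p in \<open>auto simp: N.uncoord_add N.uncoord_smult map_add map_smult M.coord_add M.coord_smult\<close>)
    then show ?thesis using A by simp
  qed
  \<comment> \<open>An inequality between operator forms yields the scalar one for every
    \<open>u\<close>, because each family of coordinates comes from some matrix
    \<open>K\<close>.\<close>
  have form_le: "(\<Sum>p\<in>sq m. g p * (cmod (\<Sum>a\<in>sq n. V p a * u a))\<^sup>2) \<le> (\<Sum>a\<in>sq n. h a * (cmod (u a))\<^sup>2)"
    if S: "M.diag_op g S" and T: "N.diag_op h T"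
      and le: "\<And>K. K \<in> carrier_mat n n \<Longrightarrow> hs_inner (\<phi> K) (S (\<phi> K)) \<le> hs_inner K (T K)" for g S h T u
  proof -
    define K where "K = N.uncoord (mat n n u)"
    have K: "K \<in> carrier_mat n n" by (simp add: K_def)
    have Ku: "N.coord K $$ a = u a" if "a \<in> sq n" for a using that by (auto simp: K_def)
    have "M.coord (\<phi> K) $$ p = (\<Sum>a\<in>sq n. V p a * u a)" if "p \<in> sq m" for p
      using V[OF K that] by (simp add: Ku)
    then have "(\<Sum>p\<in>sq m. g p * (cmod (\<Sum>a\<in>sq n. V p a * u a))\<^sup>2) = Re (hs_inner (\<phi> K) (S (\<phi> K)))"
      using M.diag_op_form[OF S map_carrier[OF K]] by simp
    also have "\<dots> \<le> Re (hs_inner K (T K))" using le[OF K] by (simp add: less_eq_complex_def)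
    also have "\<dots> = (\<Sum>a\<in>sq n. h a * (cmod (u a))\<^sup>2)" using N.diag_op_form[OF T K] by (simp add: Ku)
    finally show ?thesis .
  qed
  have main: "(\<Sum>p\<in>sq m. \<alpha> p * (cmod (M.coord (\<phi> A) $$ p))\<^sup>2) \<le> (\<Sum>a\<in>sq n. \<gamma> a * (cmod (N.coord A $$ a))\<^sup>2)"
    if A: "A \<in> carrier_mat n n" for A
  proof -
    have "(\<Sum>p\<in>sq m. f (\<kappa> (snd p) / \<mu> (fst p)) * \<mu> (fst p) * (cmod (\<Sum>a\<in>sq n. V p a * N.coord A $$ a))\<^sup>2)
      \<le> (\<Sum>a\<in>sq n. f (d (snd a) / c (fst a)) * c (fst a) * (cmod (N.coord A $$ a))\<^sup>2)"
    proof (rule hansen_perspective_inequality[OF f_opmon _ f_zero])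
      fix u
      show "(\<Sum>p\<in>sq m. \<mu> (fst p) * (cmod (\<Sum>a\<in>sq n. V p a * u a))\<^sup>2) \<le> (\<Sum>a\<in>sq n. c (fst a) * (cmod (u a))\<^sup>2)"
        by (rule form_le[OF M.diag_op_lmul[OF YU] N.diag_op_lmul[OF YP]])
          (simp add: lmul_def schwarz_lmul psdY)
      show "(\<Sum>p\<in>sq m. \<kappa> (snd p) * (cmod (\<Sum>a\<in>sq n. V p a * u a))\<^sup>2) \<le> (\<Sum>a\<in>sq n. d (snd a) * (cmod (u a))\<^sup>2)"
        by (rule form_le[OF M.diag_op_rmul[OF XW] N.diag_op_rmul[OF XQ]])
          (simp add: rmul_def schwarz_rmul psdX)
    qed (use f_pos \<mu> \<kappa> c d in \<open>auto simp: less_imp_le\<close>)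
    then show ?thesis by (simp add: \<alpha>_def \<gamma>_def V[OF A])
  qed
  have Jc: "J A \<in> carrier_mat m m" if "A \<in> carrier_mat m m" for A by (rule M.diag_op_carrier[OF J that])
  have J'c: "J' A \<in> carrier_mat n n" if "A \<in> carrier_mat n n" for A by (rule N.diag_op_carrier[OF J' that])
  have b: "op_le n (\<phi>adj \<circ> J \<circ> \<phi>) J'"
    unfolding op_le_def op_psd_def
  proof
    fix A :: "complex mat" assume A: "A \<in> carrier_mat n n"
    have "hs_inner A (J' A - (\<phi>adj \<circ> J \<circ> \<phi>) A) = hs_inner A (J' A) - hs_inner A (\<phi>adj (J (\<phi> A)))"
      using A by (simp add: hs_inner_minus_right[of _ n] Jc J'c)
    also have "hs_inner A (\<phi>adj (J (\<phi> A))) = hs_inner (\<phi> A) (J (\<phi> A))"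
      using A by (simp add: adj_inner Jc)
    finally show "0 \<le> hs_inner A (J' A - (\<phi>adj \<circ> J \<circ> \<phi>) A)"
      using main[OF A] M.diag_op_form[OF J map_carrier[OF A]] N.diag_op_form[OF J' A]
      by (simp add: less_eq_complex_def)
  qed
  define G where "G = op_mp n J'"
  define H where "H = op_inv m J"
  have G: "N.diag_op (\<lambda>p. inverse (\<gamma> p)) G" unfolding G_def by (rule N.diag_op_mp[OF J'])
  have H: "M.diag_op (\<lambda>p. inverse (\<alpha> p)) H" unfolding H_def
    by (rule M.diag_op_inv[OF J]) (use \<alpha> in force)
  have a: "op_le m (\<phi> \<circ> G \<circ> \<phi>adj) H"
    unfolding op_le_def op_psd_def
  proof
    fix B :: "complex mat" assume B: "B \<in> carrier_mat m m"
    define z where "z = \<phi>adj B"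
    \<comment> \<open>With this \<open>x\<close> both the pairing of \<open>B\<close> with
      \<open>\<phi> x\<close> and the form of \<open>J'\<close> at \<open>x\<close> equal
      \<open>r\<close>. By (b) the form of \<open>J\<close> at \<open>\<phi> x\<close> is at most
      \<open>r\<close>, and completing the square gives \<open>2 * r \<le> s + r\<close>.\<close>
    define x where "x = G z"
    have z: "z \<in> carrier_mat n n" using B by (simp add: z_def)
    have x: "x \<in> carrier_mat n n" unfolding x_def by (rule N.diag_op_carrier[OF G z])
    define r where "r = (\<Sum>p\<in>sq n. inverse (\<gamma> p) * (cmod (N.coord z $$ p))\<^sup>2)"
    define s where "s = (\<Sum>p\<in>sq m. inverse (\<alpha> p) * (cmod (M.coord B $$ p))\<^sup>2)"
    have "hs_inner (\<phi> x) B = hs_inner x z" using x B by (simp add: adj_inner z_def)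
    also have "\<dots> = hs_inner z x"
      using N.diag_op_sa[OF G] z unfolding op_sa_def x_def by blast
    also have "\<dots> = complex_of_real r" unfolding x_def r_def by (rule N.diag_op_form[OF G z])
    finally have r: "hs_inner B (\<phi> x) = complex_of_real r"
      using hs_inner_cnj[of "\<phi> x" m B] x B by simp
    have "(\<Sum>a\<in>sq n. \<gamma> a * (cmod (N.coord x $$ a))\<^sup>2) = r"
      unfolding r_def x_def
    proof (rule sum.cong[OF refl])
      fix p assume p: "p \<in> sq n"
      have "(cmod (N.coord (G z) $$ p))\<^sup>2 = (inverse (\<gamma> p))\<^sup>2 * (cmod (N.coord z $$ p))\<^sup>2"
        unfolding N.diag_op_coord[OF G z p] by (simp add: norm_mult norm_inverse power_mult_distrib power_inverse)
      \<comment> \<open>The Penrose identity for the multipliers; it survives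
        \<open>\<gamma> p = 0\<close> because \<open>inverse 0 = 0\<close>.\<close>
      moreover have "\<gamma> p * (inverse (\<gamma> p))\<^sup>2 = inverse (\<gamma> p)"
        by (cases "\<gamma> p = 0") (simp_all add: power2_eq_square)
      ultimately show "\<gamma> p * (cmod (N.coord (G z) $$ p))\<^sup>2 = inverse (\<gamma> p) * (cmod (N.coord z $$ p))\<^sup>2"
        by (simp add: mult.assoc[symmetric])
    qed
    then have le_r: "(\<Sum>p\<in>sq m. \<alpha> p * (cmod (M.coord (\<phi> x) $$ p))\<^sup>2) \<le> r" using main[OF x] by simp
    have "2 * r = (\<Sum>p\<in>sq m. 2 * Re (cnj (M.coord B $$ p) * M.coord (\<phi> x) $$ p))"
      using arg_cong[OF r, of Re] M.hs_inner_coord[OF B map_carrier[OF x]]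
      by (simp add: sum_distrib_left[symmetric] del: times_complex.sel)
    also have "\<dots> \<le> (\<Sum>p\<in>sq m. inverse (\<alpha> p) * (cmod (M.coord B $$ p))\<^sup>2 + \<alpha> p * (cmod (M.coord (\<phi> x) $$ p))\<^sup>2)"
    proof (rule sum_mono)
      fix p assume p: "p \<in> sq m"
      let ?a = "cmod (M.coord B $$ p)" and ?b = "cmod (M.coord (\<phi> x) $$ p)"
      have "Re (cnj (M.coord B $$ p) * M.coord (\<phi> x) $$ p) \<le> ?a * ?b"
        using complex_Re_le_cmod[of "cnj (M.coord B $$ p) * M.coord (\<phi> x) $$ p"] by (simp add: norm_mult)
      moreover have "inverse (\<alpha> p) * ?a\<^sup>2 + \<alpha> p * ?b\<^sup>2 - 2 * (?a * ?b) = inverse (\<alpha> p) * (?a - \<alpha> p * ?b)\<^sup>2"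
        using \<alpha>[OF p] by (simp add: field_simps power2_eq_square)
      moreover have "inverse (\<alpha> p) * (?a - \<alpha> p * ?b)\<^sup>2 \<ge> 0" using \<alpha>[OF p] by simp
      ultimately show "2 * Re (cnj (M.coord B $$ p) * M.coord (\<phi> x) $$ p) \<le> inverse (\<alpha> p) * ?a\<^sup>2 + \<alpha> p * ?b\<^sup>2"
        by linarith
    qed
    also have "\<dots> \<le> s + r" using le_r by (simp add: sum.distrib s_def)
    finally have "r \<le> s" by simp
    moreover have "hs_inner B (H B) = complex_of_real s" unfolding s_def by (rule M.diag_op_form[OF H B])
    moreover have "hs_inner B (H B - (\<phi> \<circ> G \<circ> \<phi>adj) B) = hs_inner B (H B) - hs_inner B (\<phi> x)"
      using B x M.diag_op_carrier[OF H B] by (simp add: hs_inner_minus_right[of _ m] x_def z_def)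
    ultimately show "0 \<le> hs_inner B (H B - (\<phi> \<circ> G \<circ> \<phi>adj) B)"
      using r by (simp add: less_eq_complex_def)
  qed
  show ?thesis using a b by (simp add: G_def H_def J_def J'_def)
qed

end
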